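(* Suppose that the following statement (the volumetric zone conjecture) holds: for every $d \ge 2$, every $n \ge 1$, all unit vectors $u_1, \dots, u_n \in \mathbb{S}^{d-1}$, and every $\alpha \in [0, \pi/2]$, $$\sigma_{d-1}\left(\bigcup_{j=1}^n Z(u_j,\alpha)\right) \le \sigma_{d-1}\left(\bigcup_{j=1}^n Z(v_j,\alpha)\right),$$ where $$v_j = \left(\cos\left(\tfrac{(j-1)\pi}{n}\right), \sin\left(\tfrac{(j-1)\pi}{n}\right), 0, \dots, 0\right) \in \mathbb{S}^{d-1}, \qquad j = 1,\dots,n.$$ Then, for every $n \ge 1$, every $n \times n$ correlation matrix $\Sigma$, and every $t \ge 0$, $$\mathbb{P}[M(\Sigma^{\cos}) \ge t] \le \mathbb{P}[M(\Sigma) \ge t],$$ that is, $M(\Sigma^{\cos})$ is stochastically dominated by $M(\Sigma)$; in particular, $\mathbb{E}[M(\Sigma^{\cos})^p] \le \mathbb{E}[M(\Sigma)^p]$ for every $p > 0$.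
   Context: $\mathbb{S}^{d-1}$ is the unit sphere in $\mathbb{R}^d$, and $\sigma_{d-1}$ is the surface measure on $\mathbb{S}^{d-1}$ normalized to be a probability measure. For a unit vector $u \in \mathbb{S}^{d-1}$ and $\alpha \in [0,\pi/2]$, the spherical zone is $Z(u,\alpha) = \{v \in \mathbb{S}^{d-1} : |\langle v, u\rangle| \le \sin(\alpha)\}$. An $n\times n$ correlation matrix is a real symmetric positive semidefinite matrix $\Sigma$ with $\Sigma_{ii} = 1$ for all $i = 1,\dots,n$. For an $n\times n$ correlation matrix $\Sigma$, let $z \sim \mathcal{N}(0, I_n)$ and define the random variable $M(\Sigma) = \min_{i=1}^n |(\Sigma^{1/2} z)_i|$; equivalently, $M(\Sigma)$ has the law of $\min_{i=1}^n |g_i|$ where $g \sim \mathcal{N}(0,\Sigma)$ is a centered Gaussian vector with covariance $\Sigma$. For each $n \ge 1$, $\Sigma^{\cos}$ denotes the $n\times n$ correlation matrix with entries $\Sigma^{\cos}_{ij} = \cos(\pi(i-j)/n)$, $1 \le i,j \le n$. *)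

theory Defs
  imports "HOL-Probability.Probability" "Jordan_Normal_Form.Matrix"
begin

unbundle no vec_syntax
hide_type (open) Finite_Cartesian_Product.vec
hide_const (open) Finite_Cartesian_Product.vec Finite_Cartesian_Product.row
  Finite_Cartesian_Product.column Finite_Cartesian_Product.mat
  Finite_Cartesian_Product.rows Finite_Cartesian_Product.columns
  Finite_Cartesian_Product.transpose

text \<open>
  The dimension \<open>d\<close> is quantified inside a hypothesis, so it cannot be a type. The space
  \<open>\<real>\<^sup>d\<close> is the set of functions \<open>nat \<Rightarrow> real\<close> extensional on \<open>{..<d}\<close>, that is, the space
  of the product measure \<open>\<Pi>\<^sub>M i\<in>{..<d}. lborel\<close>. All indices run from \<open>0\<close>.
\<close>

definition inner_on :: "nat \<Rightarrow> (nat \<Rightarrow> real) \<Rightarrow> (nat \<Rightarrow> real) \<Rightarrow> real" where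
  "inner_on d x y = (\<Sum>i<d. x i * y i)"

definition norm_on :: "nat \<Rightarrow> (nat \<Rightarrow> real) \<Rightarrow> real" where
  "norm_on d x = sqrt (inner_on d x x)"

definition unit_sphere :: "nat \<Rightarrow> (nat \<Rightarrow> real) set" where
  "unit_sphere d = {x \<in> {..<d} \<rightarrow>\<^sub>E UNIV. norm_on d x = 1}"

definition unit_ball :: "nat \<Rightarrow> (nat \<Rightarrow> real) set" where
  "unit_ball d = {x \<in> {..<d} \<rightarrow>\<^sub>E UNIV. norm_on d x \<le> 1}"

definition radial_proj :: "nat \<Rightarrow> (nat \<Rightarrow> real) \<Rightarrow> nat \<Rightarrow> real" where
  "radial_proj d x = (\<lambda>i\<in>{..<d}. x i / norm_on d x)"

text \<open>
  Normalized surface measure, by the polar-coordinates definition: the measure of a Borel set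
  \<open>A\<close> of the sphere is the Lebesgue measure of the cone \<open>{r a | a \<in> A, 0 < r \<le> 1}\<close> divided by
  that of the unit ball. The origin, which \<open>radial_proj\<close> sends to \<open>0\<close>, is a null set for \<open>d \<ge> 1\<close>.
\<close>

definition sphere_measure :: "nat \<Rightarrow> (nat \<Rightarrow> real) measure" where
  "sphere_measure d =
     restrict_space
       (distr (uniform_measure (\<Pi>\<^sub>M i\<in>{..<d}. lborel) (unit_ball d))
              (\<Pi>\<^sub>M i\<in>{..<d}. borel) (radial_proj d))
       (unit_sphere d)"

definition zone :: "nat \<Rightarrow> (nat \<Rightarrow> real) \<Rightarrow> real \<Rightarrow> (nat \<Rightarrow> real) set" where
  "zone d u \<alpha> = {v \<in> unit_sphere d. \<bar>inner_on d v u\<bar> \<le> sin \<alpha>}"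

definition planar_vec :: "nat \<Rightarrow> nat \<Rightarrow> nat \<Rightarrow> nat \<Rightarrow> real" where
  "planar_vec d n j =
     (\<lambda>k\<in>{..<d}. if k = 0 then cos (real j * pi / real n)
                 else if k = 1 then sin (real j * pi / real n) else 0)"

definition volumetric_zone_conjecture :: bool where
  "volumetric_zone_conjecture \<longleftrightarrow>
     (\<forall>d\<ge>2. \<forall>n\<ge>1. \<forall>u :: nat \<Rightarrow> nat \<Rightarrow> real. \<forall>\<alpha>\<in>{0..pi/2}.
        (\<forall>j<n. u j \<in> unit_sphere d) \<longrightarrow>
        measure (sphere_measure d) (\<Union>j<n. zone d (u j) \<alpha>)
          \<le> measure (sphere_measure d) (\<Union>j<n. zone d (planar_vec d n j) \<alpha>))"

definition psd_mat :: "nat \<Rightarrow> real mat \<Rightarrow> bool" where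
  "psd_mat n A \<longleftrightarrow> A \<in> carrier_mat n n \<and> transpose_mat A = A \<and>
     (\<forall>x\<in>carrier_vec n. 0 \<le> x \<bullet> (A *\<^sub>v x))"

definition correlation_mat :: "nat \<Rightarrow> real mat \<Rightarrow> bool" where
  "correlation_mat n A \<longleftrightarrow> psd_mat n A \<and> (\<forall>i<n. A $$ (i, i) = 1)"

definition cos_mat :: "nat \<Rightarrow> real mat" where
  "cos_mat n = mat n n (\<lambda>(i, j). cos (pi * (real i - real j) / real n))"

text \<open>The unique positive semidefinite square root of a positive semidefinite matrix.\<close>

definition psd_sqrt :: "nat \<Rightarrow> real mat \<Rightarrow> real mat" where
  "psd_sqrt n A = (THE B. psd_mat n B \<and> B * B = A)"

text \<open>The law \<open>N(0, I\<^sub>n)\<close>.\<close>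

definition std_gaussian :: "nat \<Rightarrow> (nat \<Rightarrow> real) measure" where
  "std_gaussian n = (\<Pi>\<^sub>M i\<in>{..<n}. std_normal_distribution)"

text \<open>
  The random variable \<open>M(A) = min\<^sub>i \<bar>(A\<^sup>1\<^sup>/\<^sup>2 z)\<^sub>i\<bar>\<close> on the probability space \<open>std_gaussian n\<close>,
  meant for \<open>n \<ge> 1\<close>.
\<close>

definition min_abs :: "nat \<Rightarrow> real mat \<Rightarrow> (nat \<Rightarrow> real) \<Rightarrow> real" where
  "min_abs n A z = (MIN i\<in>{..<n}. \<bar>(psd_sqrt n A *\<^sub>v vec n z) $ i\<bar>)"

end

theory Submission
  imports Defs
begin

unbundle no inner_syntax

text \<open>
  Let \<open>b\<^sub>j\<close> be the rows of \<open>A\<^sup>1\<^sup>/\<^sup>2\<close>. They are unit vectors and \<open>M(A)\<close> is the minimum of the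
  \<open>\<bar>\<langle>b\<^sub>j, z\<rangle>\<bar>\<close>, that is, \<open>\<bar>z\<bar>\<close> times a function of the direction of \<open>z\<close>. The zone conjecture in
  dimension \<open>n\<close> compares the distribution of this directional factor with the one obtained from the
  planar vectors \<open>v\<^sub>j\<close>, and the norm of a Gaussian vector is independent of its direction, so the
  comparison carries over to the product. Finally, the \<open>v\<^sub>j\<close> have Gram matrix \<open>\<Sigma>\<^sup>c\<^sup>o\<^sup>s\<close>, hence by
  rotation invariance they give the same law of the minimum as the rows of the square root of
  \<open>\<Sigma>\<^sup>c\<^sup>o\<^sup>s\<close>. For \<open>n = 1\<close> there is only one correlation matrix.
\<close>

subsection \<open>Square roots of positive semidefinite matrices\<close>

text \<open>\<open>psd_sqrt\<close> is a definite description, so nothing is known about it before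
  existence and uniqueness are proved. Existence evaluates the power series of sqrt (1 - x) at the
  contraction \<open>1 - A / K\<close>; uniqueness is a trace identity. The conjecture speaks of
  \<open>sphere_measure\<close>, the projection of the uniform measure on a ball. It meets the
  Gaussian measure on cones, where both give the same mass because the Gaussian is a mixture of
  uniform distributions on centred balls. The same mixture yields the independence of norm and
  direction. Zones are closed conditions, so their complements give tails with a strict inequality;
  the non-strict tails of the claim are limits of these. The cosine matrix has rank at most two.
  Rotation invariance is therefore only required for the joint law of the inner products with two
  orthonormal vectors, and rotations in coordinate planes together with sign flips provide
  it.\<close>

lemma scalar_prod_mult_mat_vec:
  fixes x :: "real vec"
  assumes "M \<in> carrier_mat n n" "x \<in> carrier_vec n" "y \<in> carrier_vec n"
  shows "x \<bullet> (M *\<^sub>v y) = (\<Sum>i<n. \<Sum>j<n. x $ i * M $$ (i, j) * y $ j)"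
proof -
  have "x \<bullet> (M *\<^sub>v y) = (\<Sum>i<n. x $ i * (\<Sum>j<n. M $$ (i, j) * y $ j))"
    using assms by (auto simp: scalar_prod_def atLeast0LessThan intro!: sum.cong)
  then show ?thesis by (simp add: sum_distrib_left mult.assoc)
qed

lemma scalar_prod_Cauchy_Schwarz:
  fixes x y :: "real vec"
  assumes "x \<in> carrier_vec n" "y \<in> carrier_vec n"
  shows "(x \<bullet> y)\<^sup>2 \<le> (x \<bullet> x) * (y \<bullet> y)"
  using Cauchy_Schwarz_ineq_sum[of "\<lambda>i. x $ i" "\<lambda>i. y $ i" "{0..<n}"] assms
  by (simp add: scalar_prod_def power2_eq_square)

lemma scalar_prod_self_nonneg: "0 \<le> x \<bullet> (x :: real vec)"
  by (auto simp: scalar_prod_def intro!: sum_nonneg)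

lemma scalar_prod_self_eq_0:
  fixes x :: "real vec"
  assumes "x \<in> carrier_vec n" "x \<bullet> x = 0"
  shows "x = 0\<^sub>v n"
proof
  show "dim_vec x = dim_vec (0\<^sub>v n)" using assms by simp
  fix i assume i: "i < dim_vec (0\<^sub>v n)"
  have "(\<Sum>i\<in>{0..<n}. x $ i * x $ i) = 0" using assms by (simp add: scalar_prod_def)
  then have "\<forall>i\<in>{0..<n}. x $ i * x $ i = 0" by (subst (asm) sum_nonneg_eq_0_iff) auto
  then show "x $ i = 0\<^sub>v n $ i" using i by auto
qed

lemma index_eq_scalar_prod_unit_vec:
  fixes M :: "real mat"
  assumes "M \<in> carrier_mat n n" "i < n" "j < n"
  shows "M $$ (i, j) = unit_vec n i \<bullet> (M *\<^sub>v unit_vec n j)"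
  using assms by (subst scalar_prod_left_unit[of _ n]) auto

lemma symmetric_scalar_prod:
  fixes M :: "real mat"
  assumes "M \<in> carrier_mat n n" "transpose_mat M = M" "x \<in> carrier_vec n" "y \<in> carrier_vec n"
  shows "(M *\<^sub>v x) \<bullet> y = x \<bullet> (M *\<^sub>v y)"
  using transpose_vec_mult_scalar[of M n n y x] assms by simp

lemma pow_mat_contraction:
  fixes T :: "real mat"
  assumes T: "T \<in> carrier_mat n n"
    and contr: "\<And>x. x \<in> carrier_vec n \<Longrightarrow> (T *\<^sub>v x) \<bullet> (T *\<^sub>v x) \<le> x \<bullet> x"
    and "x \<in> carrier_vec n"
  shows "((T ^\<^sub>m k) *\<^sub>v x) \<bullet> ((T ^\<^sub>m k) *\<^sub>v x) \<le> x \<bullet> x"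
  using assms(3)
proof (induction k arbitrary: x)
  case 0
  then show ?case using T by simp
next
  case (Suc k)
  have "T ^\<^sub>m Suc k *\<^sub>v x = T ^\<^sub>m k *\<^sub>v (T *\<^sub>v x)"
    using T Suc.prems by (simp add: assoc_mult_mat_vec[of _ n n])
  then show ?case
    using Suc.IH[of "T *\<^sub>v x"] contr[of x] T Suc.prems by simp
qed

lemma pow_mat_add:
  fixes T :: "real mat"
  assumes T: "T \<in> carrier_mat n n"
  shows "T ^\<^sub>m a * T ^\<^sub>m b = T ^\<^sub>m (a + b)"
proof (induction b)
  case 0
  then show ?case using T by simp
next
  case (Suc b)
  have "T ^\<^sub>m a * T ^\<^sub>m Suc b = (T ^\<^sub>m a * T ^\<^sub>m b) * T"
    using T by (simp add: assoc_mult_mat[of "T ^\<^sub>m a" n n "T ^\<^sub>m b" n T n])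
  then show ?case using Suc by simp
qed

lemma pow_mat_symmetric:
  fixes T :: "real mat"
  assumes T: "T \<in> carrier_mat n n" and sym: "transpose_mat T = T"
  shows "transpose_mat (T ^\<^sub>m k) = T ^\<^sub>m k"
proof (induction k)
  case 0
  then show ?case using T by simp
next
  case (Suc k)
  have "transpose_mat (T ^\<^sub>m Suc k) = T * T ^\<^sub>m k"
    using T Suc by (simp add: transpose_mult[of _ n n] sym)
  also have "\<dots> = T ^\<^sub>m Suc k"
    using pow_mat_add[OF T, of 1 k] T by simp
  finally show ?case .
qed

text \<open>The coefficients of the power series of \<open>sqrt (1 - x)\<close>.\<close>

definition sqrt_coeff :: "nat \<Rightarrow> real" where
  "sqrt_coeff k = (1/2 gchoose k) * (- 1) ^ k"

lemma sqrt_coeff_0: "sqrt_coeff 0 = 1"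
  by (simp add: sqrt_coeff_def)

text \<open>Negating the upper index turns the signed binomial into
  \<open>k - 3/2 gchoose k\<close>. Its numerator is the product of \<open>k - 3/2 - i\<close> over
  \<open>i < k\<close>; the factor at \<open>i = k - 1\<close> is \<open>- 1/2\<close> and all
  others are positive.\<close>

lemma sqrt_coeff_nonpos:
  assumes "0 < k"
  shows "sqrt_coeff k \<le> 0"
proof -
  obtain m where m: "k = Suc m" using assms gr0_implies_Suc by blast
  have "sqrt_coeff k = (of_nat k - 1/2 - 1 gchoose k)"
    unfolding sqrt_coeff_def by (subst gbinomial_negated_upper) (simp flip: power_mult_distrib)
  also have "\<dots> = (\<Prod>i = 0..<k. real k - 3/2 - real i) / fact k"
    by (simp add: gbinomial_prod_rev)
  also have "(\<Prod>i = 0..<k. real k - 3/2 - real i) = (\<Prod>i = 0..<m. real k - 3/2 - real i) * (- 1/2)"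
    by (simp add: m)
  also have "(\<Prod>i = 0..<m. real k - 3/2 - real i) * (- 1/2) / fact k \<le> 0"
    by (intro divide_nonpos_pos mult_nonneg_nonpos prod_nonneg) (auto simp: m)
  finally show ?thesis .
qed

text \<open>Partial sums of the coefficients of sqrt (1 - x) are the coefficients of sqrt (1 - x) /
  (1 - x), the inverse square root of 1 - x, and these are products of positive factors.\<close>

lemma sqrt_coeff_sum_nonneg: "0 \<le> (\<Sum>k\<le>m. sqrt_coeff k)"
proof -
  have "(\<Sum>k\<le>m. sqrt_coeff k) = (- 1) ^ m * (1/2 - 1 gchoose m)"
    unfolding sqrt_coeff_def by (rule gbinomial_sum_lower_neg)
  also have "\<dots> = (of_nat m - (1/2 - 1) - 1 gchoose m)"
    by (subst gbinomial_negated_upper) (simp flip: power_mult_distrib mult.assoc)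
  also have "\<dots> = (\<Prod>i = 0..<m. real m - 1/2 - real i) / fact m"
    by (simp add: gbinomial_prod_rev)
  also have "\<dots> \<ge> 0"
    by (intro divide_nonneg_pos prod_nonneg) auto
  finally show ?thesis .
qed

text \<open>The square of the series is 1 - x: Vandermonde adds the two upper indices 1/2 to
  1.\<close>

lemma sqrt_coeff_convolution:
  "(\<Sum>i\<le>k. sqrt_coeff i * sqrt_coeff (k - i)) = (if k = 0 then 1 else if k = 1 then - 1 else 0)"
proof -
  have "(\<Sum>i\<le>k. sqrt_coeff i * sqrt_coeff (k - i))
      = (\<Sum>i\<le>k. (1/2 gchoose i) * (1/2 gchoose (k - i)) * (- 1) ^ k)"
    by (intro sum.cong) (auto simp: sqrt_coeff_def simp flip: power_add)
  also have "\<dots> = (1/2 + 1/2 gchoose k) * (- 1) ^ k"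
    using gbinomial_Vandermonde[of "1/2 :: real" "1/2" k] by (simp add: atMost_atLeast0 flip: sum_distrib_right)
  also have "(1/2 + 1/2 :: real) = of_nat 1" by simp
  also have "(of_nat 1 gchoose k) = (of_nat (1 choose k) :: real)"
    by (simp add: binomial_gbinomial)
  finally show ?thesis by (cases k) (auto simp: binomial_eq_0)
qed

text \<open>Only the coefficient at 0 is positive, so the absolute values add up to 2 minus a
  nonnegative partial sum. The resulting absolute summability allows evaluation at an operator of
  norm exactly 1, which is what a singular matrix leads to.\<close>

lemma sqrt_coeff_abs_sum: "(\<Sum>k\<le>m. \<bar>sqrt_coeff k\<bar>) \<le> 2"
proof -
  have "(\<Sum>k\<le>m. \<bar>sqrt_coeff k\<bar>) = (\<Sum>k\<le>m. (if k = 0 then 2 else 0) - sqrt_coeff k)"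
    using sqrt_coeff_nonpos by (intro sum.cong) (auto simp: sqrt_coeff_0 abs_of_nonpos)
  also have "\<dots> \<le> 2"
    using sqrt_coeff_sum_nonneg[of m] by (simp add: sum_subtractf)
  finally show ?thesis .
qed

lemma summable_sqrt_coeff: "summable (\<lambda>k. \<bar>sqrt_coeff k\<bar>)"
proof (rule bounded_imp_summable[of _ 2])
  show "(\<Sum>k\<le>m. \<bar>sqrt_coeff k\<bar>) \<le> 2" for m by (rule sqrt_coeff_abs_sum)
qed auto

lemma sqrt_coeff_suminf_nonneg: "0 \<le> (\<Sum>k. sqrt_coeff k)"
proof (rule LIMSEQ_le_const)
  show "(\<lambda>m. \<Sum>k\<le>m. sqrt_coeff k) \<longlonglongrightarrow> (\<Sum>k. sqrt_coeff k)"
    by (rule summable_LIMSEQ', rule summable_rabs_cancel, rule summable_sqrt_coeff)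
qed (use sqrt_coeff_sum_nonneg in auto)

text \<open>\<open>B\<close> is the series of sqrt (1 - x) at \<open>T\<close>, taken entrywise, and
  the Cauchy product computes its square. For positivity, the form of \<open>T ^\<^sub>m k\<close>
  at \<open>x\<close> is at most \<open>x \<bullet> x\<close> and all coefficients after the first
  are nonpositive; hence the form of \<open>B\<close> is at least \<open>x \<bullet> x\<close> times
  the total of the coefficients, which is nonnegative.\<close>

lemma psd_sqrt_exists_of_contraction:
  assumes T: "T \<in> carrier_mat n n" and sym: "transpose_mat T = T"
    and contr: "\<And>x. x \<in> carrier_vec n \<Longrightarrow> (T *\<^sub>v x) \<bullet> (T *\<^sub>v x) \<le> x \<bullet> x"
  shows "\<exists>B. psd_mat n B \<and> B * B = 1\<^sub>m n - T"
proof -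
  have Tk: "T ^\<^sub>m k \<in> carrier_mat n n" for k using T by simp
  have le: "\<bar>x \<bullet> ((T ^\<^sub>m k) *\<^sub>v y)\<bar> \<le> sqrt (x \<bullet> x) * sqrt (y \<bullet> y)"
    if "x \<in> carrier_vec n" "y \<in> carrier_vec n" for x y k
  proof -
    have "(x \<bullet> ((T ^\<^sub>m k) *\<^sub>v y))\<^sup>2
        \<le> (x \<bullet> x) * (((T ^\<^sub>m k) *\<^sub>v y) \<bullet> ((T ^\<^sub>m k) *\<^sub>v y))"
      using that Tk by (intro scalar_prod_Cauchy_Schwarz[of _ n] mult_mat_vec_carrier) auto
    also have "\<dots> \<le> (x \<bullet> x) * (y \<bullet> y)"
      using that pow_mat_contraction[OF T contr] by (intro mult_left_mono scalar_prod_self_nonneg) auto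
    finally show ?thesis
      by (metis real_sqrt_abs real_sqrt_le_iff real_sqrt_mult)
  qed
  define s where "s = sqrt_coeff"
  define B where "B = mat n n (\<lambda>(i, j). \<Sum>k. s k * (T ^\<^sub>m k) $$ (i, j))"
  have B: "B \<in> carrier_mat n n" by (simp add: B_def)
  have entry_le: "\<bar>(T ^\<^sub>m k) $$ (i, j)\<bar> \<le> 1" if "i < n" "j < n" for i j k
    using le[of "unit_vec n i" "unit_vec n j" k] that
    by (simp add: index_eq_scalar_prod_unit_vec[OF Tk that] del: scalar_prod_left_unit)
  have summ: "summable (\<lambda>k. norm (s k * (T ^\<^sub>m k) $$ (i, j)))" if "i < n" "j < n" for i j
  proof (rule summable_comparison_test[OF _ summable_sqrt_coeff])
    show "\<exists>N. \<forall>k\<ge>N. norm (norm (s k * (T ^\<^sub>m k) $$ (i, j))) \<le> \<bar>sqrt_coeff k\<bar>"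
      using mult_left_mono[OF entry_le[OF that], of "\<bar>s _\<bar>"] by (auto simp: abs_mult s_def)
  qed
  have sums: "(\<lambda>k. s k * (T ^\<^sub>m k) $$ (i, j)) sums (B $$ (i, j))" if "i < n" "j < n" for i j
    using summable_sums[OF summable_norm_cancel[OF summ[OF that]]] that by (simp add: B_def)
  have "transpose_mat B = B"
  proof (rule eq_matI)
    fix i j assume "i < dim_row B" "j < dim_col B"
    then have ij: "i < n" "j < n" using B by auto
    have "(T ^\<^sub>m k) $$ (j, i) = (T ^\<^sub>m k) $$ (i, j)" for k
      using arg_cong[OF pow_mat_symmetric[OF T sym, of k], of "\<lambda>M. M $$ (i, j)"] ij T by simp
    then show "transpose_mat B $$ (i, j) = B $$ (i, j)" using ij by (simp add: B_def)
  qed (use B in auto)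
  moreover have "0 \<le> x \<bullet> (B *\<^sub>v x)" if x: "x \<in> carrier_vec n" for x
  proof -
    have "(\<lambda>k. \<Sum>i<n. \<Sum>j<n. x $ i * (s k * (T ^\<^sub>m k) $$ (i, j)) * x $ j)
        sums (\<Sum>i<n. \<Sum>j<n. x $ i * B $$ (i, j) * x $ j)"
      by (intro sums_sum sums_mult sums_mult2 sums) auto
    then have s1: "(\<lambda>k. s k * (x \<bullet> ((T ^\<^sub>m k) *\<^sub>v x))) sums (x \<bullet> (B *\<^sub>v x))"
      by (simp add: scalar_prod_mult_mat_vec[OF B x x] scalar_prod_mult_mat_vec[OF Tk x x]
          sum_distrib_left mult_ac)
    have s2: "(\<lambda>k. s k * (x \<bullet> x)) sums ((\<Sum>k. s k) * (x \<bullet> x))"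
      unfolding s_def
      by (rule sums_mult2[OF summable_sums[OF summable_rabs_cancel[OF summable_sqrt_coeff]]])
    have ge: "s k * (x \<bullet> x) \<le> s k * (x \<bullet> ((T ^\<^sub>m k) *\<^sub>v x))" for k
    proof (cases "k = 0")
      case False
      have "x \<bullet> ((T ^\<^sub>m k) *\<^sub>v x) \<le> x \<bullet> x"
        using le[OF x x, of k] by (simp add: scalar_prod_self_nonneg)
      then show ?thesis using sqrt_coeff_nonpos[of k] False
        by (intro mult_left_mono_neg) (auto simp: s_def)
    qed (use T x in simp)
    have "(\<Sum>k. s k) * (x \<bullet> x) \<le> x \<bullet> (B *\<^sub>v x)"
      by (rule sums_le[OF ge s2 s1])
    moreover have "0 \<le> (\<Sum>k. s k) * (x \<bullet> x)"
      unfolding s_def by (intro mult_nonneg_nonneg sqrt_coeff_suminf_nonneg scalar_prod_self_nonneg)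
    ultimately show ?thesis by linarith
  qed
  moreover have "B * B = 1\<^sub>m n - T"
  proof (rule eq_matI)
    fix i j assume "i < dim_row (1\<^sub>m n - T)" "j < dim_col (1\<^sub>m n - T)"
    then have ij: "i < n" "j < n" using T by auto
    have prod: "(T ^\<^sub>m (a + b)) $$ (i, j) = (\<Sum>l<n. (T ^\<^sub>m a) $$ (i, l) * (T ^\<^sub>m b) $$ (l, j))" for a b
      using ij T by (simp flip: pow_mat_add[OF T] add: scalar_prod_def atLeast0LessThan)
    have "(\<lambda>k. \<Sum>l<n. \<Sum>a\<le>k. (s a * (T ^\<^sub>m a) $$ (i, l)) * (s (k - a) * (T ^\<^sub>m (k - a)) $$ (l, j)))
        sums (\<Sum>l<n. B $$ (i, l) * B $$ (l, j))"
    proof (rule sums_sum)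
      fix l assume "l \<in> {..<n}"
      then show "(\<lambda>k. \<Sum>a\<le>k. (s a * (T ^\<^sub>m a) $$ (i, l)) * (s (k - a) * (T ^\<^sub>m (k - a)) $$ (l, j)))
        sums (B $$ (i, l) * B $$ (l, j))"
        using Cauchy_product_sums[OF summ[of i l] summ[of l j]]
          sums_unique[OF sums[of i l]] sums_unique[OF sums[of l j]] ij by simp
    qed
    moreover have "(\<Sum>l<n. \<Sum>a\<le>k. (s a * (T ^\<^sub>m a) $$ (i, l)) * (s (k - a) * (T ^\<^sub>m (k - a)) $$ (l, j)))
        = (\<Sum>a\<le>k. s a * s (k - a)) * (T ^\<^sub>m k) $$ (i, j)" for k
    proof -
      have "(\<Sum>l<n. \<Sum>a\<le>k. (s a * (T ^\<^sub>m a) $$ (i, l)) * (s (k - a) * (T ^\<^sub>m (k - a)) $$ (l, j)))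
        = (\<Sum>a\<le>k. s a * s (k - a) * (\<Sum>l<n. (T ^\<^sub>m a) $$ (i, l) * (T ^\<^sub>m (k - a)) $$ (l, j)))"
        by (subst sum.swap) (simp add: sum_distrib_left mult_ac)
      also have "\<dots> = (\<Sum>a\<le>k. s a * s (k - a) * (T ^\<^sub>m k) $$ (i, j))"
        by (intro sum.cong refl) (simp flip: prod)
      finally show ?thesis by (simp add: sum_distrib_right)
    qed
    \<comment> \<open>The coefficients of 1 - x: only the powers 0 and 1 of \<open>T\<close>
      survive.\<close>
    ultimately have "(\<lambda>k. (if k = 0 then 1 else if k = 1 then - 1 else 0) * (T ^\<^sub>m k) $$ (i, j))
        sums (\<Sum>l<n. B $$ (i, l) * B $$ (l, j))"
      by (simp add: s_def sqrt_coeff_convolution)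
    moreover have "(\<lambda>k. (if k = 0 then 1 else if k = 1 then - 1 else 0) * (T ^\<^sub>m k) $$ (i, j))
        sums (\<Sum>k\<in>{0,1}. (if k = 0 then 1 else if k = 1 then - 1 else 0) * (T ^\<^sub>m k) $$ (i, j))"
      by (rule sums_finite) auto
    ultimately have "(\<Sum>l<n. B $$ (i, l) * B $$ (l, j)) = 1\<^sub>m n $$ (i, j) - T $$ (i, j)"
      using sums_unique2 T by fastforce
    then show "(B * B) $$ (i, j) = (1\<^sub>m n - T) $$ (i, j)"
      using ij B T by (simp add: scalar_prod_def atLeast0LessThan)
  qed (use B T in auto)
  ultimately show ?thesis using B by (auto simp: psd_mat_def)
qed

section \<open>General positive semidefinite matrices: existence and uniqueness of the root\<close>

text \<open>Once \<open>K\<close> dominates the quadratic form, its nonnegativity at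
  \<open>x - t A x\<close> bounds the square norm of \<open>A x\<close>. The bound serves twice: it
  makes \<open>1 - A / K\<close> a contraction, and it puts every zero of the form into the
  kernel.\<close>

lemma psd_mat_quadratic_bound:
  assumes "psd_mat n A"
  shows "\<exists>K>0. (\<forall>x\<in>carrier_vec n. (A *\<^sub>v x) \<bullet> (A *\<^sub>v x) \<le> K * (x \<bullet> (A *\<^sub>v x)))"
proof -
  have A: "A \<in> carrier_mat n n" "transpose_mat A = A"
    and psd: "\<And>x. x \<in> carrier_vec n \<Longrightarrow> 0 \<le> x \<bullet> (A *\<^sub>v x)"
    using assms by (auto simp: psd_mat_def)
  \<comment> \<open>The absolute entries dominate the form since each product of two entries of
    \<open>x\<close> is at most \<open>x \<bullet> x\<close> in absolute value; the summand 1 keeps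
    \<open>K\<close> positive for the zero matrix.\<close>
  define K where "K = 1 + (\<Sum>i<n. \<Sum>j<n. \<bar>A $$ (i, j)\<bar>)"
  have K: "K > 0" by (auto simp: K_def intro!: add_pos_nonneg sum_nonneg)
  have le: "x \<bullet> (A *\<^sub>v x) \<le> K * (x \<bullet> x)" if x: "x \<in> carrier_vec n" for x
  proof -
    have comp: "(x $ i)\<^sup>2 \<le> x \<bullet> x" if "i < n" for i
      using x that member_le_sum[of i "{0..<n}" "\<lambda>i. (x $ i)\<^sup>2"]
      by (simp add: scalar_prod_def power2_eq_square)
    have prod: "\<bar>x $ i * x $ j\<bar> \<le> x \<bullet> x" if "i < n" "j < n" for i j
    proof -
      have "2 * \<bar>x $ i * x $ j\<bar> \<le> (x $ i)\<^sup>2 + (x $ j)\<^sup>2"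
        using sum_squares_bound[of "\<bar>x $ i\<bar>" "\<bar>x $ j\<bar>"] by (simp add: abs_mult)
      then show ?thesis using comp[of i] comp[of j] that by linarith
    qed
    have "x $ i * A $$ (i, j) * x $ j \<le> \<bar>A $$ (i, j)\<bar> * (x \<bullet> x)" if "i < n" "j < n" for i j
    proof -
      have "x $ i * A $$ (i, j) * x $ j \<le> \<bar>A $$ (i, j) * (x $ i * x $ j)\<bar>"
        by (simp add: mult_ac abs_ge_self)
      also have "\<dots> \<le> \<bar>A $$ (i, j)\<bar> * (x \<bullet> x)"
        unfolding abs_mult[of "A $$ (i, j)"] using prod[OF that]
        by (intro mult_left_mono) auto
      finally show ?thesis .
    qed
    then have "x \<bullet> (A *\<^sub>v x) \<le> (\<Sum>i<n. \<Sum>j<n. \<bar>A $$ (i, j)\<bar> * (x \<bullet> x))"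
      unfolding scalar_prod_mult_mat_vec[OF A(1) x x] by (intro sum_mono) auto
    also have "\<dots> \<le> K * (x \<bullet> x)"
      by (simp add: K_def ring_distribs scalar_prod_self_nonneg flip: sum_distrib_right)
    finally show ?thesis .
  qed
  have "(A *\<^sub>v x) \<bullet> (A *\<^sub>v x) \<le> K * (x \<bullet> (A *\<^sub>v x))" if x: "x \<in> carrier_vec n" for x
  proof -
    define w where "w = A *\<^sub>v x"
    have w: "w \<in> carrier_vec n" and Aw: "A *\<^sub>v w \<in> carrier_vec n"
      using A x by (auto simp: w_def)
    \<comment> \<open>This value minimizes the upper bound \<open>x \<bullet> w - 2 * t * (w
      \<bullet> w) + t\<^sup>2 * (K * (w \<bullet> w))\<close> below.\<close>
    define t where "t = 1 / K"
    have "0 \<le> (x - t \<cdot>\<^sub>v w) \<bullet> (A *\<^sub>v (x - t \<cdot>\<^sub>v w))"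
      using x w by (intro psd) auto
    also have "A *\<^sub>v (x - t \<cdot>\<^sub>v w) = w - t \<cdot>\<^sub>v (A *\<^sub>v w)"
      using A x w by (simp add: mult_minus_distrib_mat_vec[of A n n] mult_mat_vec[of A n n] flip: w_def)
    also have "(x - t \<cdot>\<^sub>v w) \<bullet> (w - t \<cdot>\<^sub>v (A *\<^sub>v w))
        = x \<bullet> w - t * (w \<bullet> w) - t * (x \<bullet> (A *\<^sub>v w)) + t\<^sup>2 * (w \<bullet> (A *\<^sub>v w))"
      using x w Aw
      by (simp add: minus_scalar_prod_distrib[of _ n] scalar_prod_minus_distrib[of _ n]
          power2_eq_square algebra_simps)
    also have "x \<bullet> (A *\<^sub>v w) = w \<bullet> w"
      using symmetric_scalar_prod[OF A x w] by (simp add: w_def)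
    finally have "0 \<le> x \<bullet> w - 2 * t * (w \<bullet> w) + t\<^sup>2 * (w \<bullet> (A *\<^sub>v w))" by simp
    also have "\<dots> \<le> x \<bullet> w - 2 * t * (w \<bullet> w) + t\<^sup>2 * (K * (w \<bullet> w))"
      using le[OF w] by (intro add_left_mono mult_left_mono) auto
    also have "\<dots> = x \<bullet> w - (w \<bullet> w) / K"
      using K by (simp add: t_def power2_eq_square field_simps)
    finally show ?thesis using K by (simp add: w_def field_simps)
  qed
  with K show ?thesis by blast
qed

lemma smult_mat_mult_vec:
  assumes "x \<in> carrier_vec (dim_col M)"
  shows "(c \<cdot>\<^sub>m M) *\<^sub>v x = c \<cdot>\<^sub>v (M *\<^sub>v (x :: real vec))"
  using assms by (intro eq_vecI) auto

lemma transpose_smult_mat: "transpose_mat (c \<cdot>\<^sub>m M) = c \<cdot>\<^sub>m transpose_mat M"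
  by (rule eq_matI) auto

text \<open>For \<open>w = A x\<close>, expanding the square norm of \<open>x - w / K\<close> gives
  \<open>x \<bullet> x - 2 / K * (x \<bullet> w) + (w \<bullet> w) / K\<^sup>2\<close>. The
  quadratic bound absorbs the last term into half of the middle one, so \<open>T\<close> is a
  contraction with \<open>1 - T = A / K\<close>; its root is then rescaled by
  \<open>sqrt K\<close>.\<close>

lemma psd_sqrt_exists:
  assumes psd: "psd_mat n A"
  shows "\<exists>B. psd_mat n B \<and> B * B = A"
proof -
  have A: "A \<in> carrier_mat n n" "transpose_mat A = A"
    using assms by (auto simp: psd_mat_def)
  obtain K where K: "K > 0"
    "\<And>x. x \<in> carrier_vec n \<Longrightarrow> (A *\<^sub>v x) \<bullet> (A *\<^sub>v x) \<le> K * (x \<bullet> (A *\<^sub>v x))"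
    using psd_mat_quadratic_bound[OF psd] by blast
  define T where "T = 1\<^sub>m n - (1 / K) \<cdot>\<^sub>m A"
  have T: "T \<in> carrier_mat n n" using A unfolding T_def by (intro minus_carrier_mat smult_carrier_mat)
  have "transpose_mat T = T"
    using A by (simp add: T_def transpose_minus[of _ n n] transpose_smult_mat)
  moreover have "(T *\<^sub>v x) \<bullet> (T *\<^sub>v x) \<le> x \<bullet> x" if x: "x \<in> carrier_vec n" for x
  proof -
    define w where "w = A *\<^sub>v x"
    have w: "w \<in> carrier_vec n" using A x by (simp add: w_def)
    have "T *\<^sub>v x = x - (1 / K) \<cdot>\<^sub>v w"
      using A x by (simp add: T_def w_def minus_mult_distrib_mat_vec[of _ n n] smult_mat_mult_vec)
    then have "(T *\<^sub>v x) \<bullet> (T *\<^sub>v x) = x \<bullet> x - 2 / K * (x \<bullet> w) + (w \<bullet> w) / K\<^sup>2"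
      using x w by (simp add: minus_scalar_prod_distrib[of _ n] scalar_prod_minus_distrib[of _ n]
          power2_eq_square algebra_simps comm_scalar_prod[of w n x])
    also have "\<dots> \<le> x \<bullet> x - 2 / K * (x \<bullet> w) + (K * (x \<bullet> w)) / K\<^sup>2"
      using K(2)[OF x] by (intro add_left_mono divide_right_mono) (auto simp: w_def)
    also have "\<dots> = x \<bullet> x - (x \<bullet> w) / K"
      using K by (simp add: power2_eq_square field_simps)
    also have "\<dots> \<le> x \<bullet> x"
      using K psd x by (auto simp: psd_mat_def w_def)
    finally show ?thesis .
  qed
  ultimately obtain C where C: "psd_mat n C" "C * C = 1\<^sub>m n - T"
    using psd_sqrt_exists_of_contraction[OF T] by blast
  have Cc: "C \<in> carrier_mat n n" "transpose_mat C = C" using C by (auto simp: psd_mat_def)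
  have CA: "C * C = (1 / K) \<cdot>\<^sub>m A" using C A by (auto simp: T_def)
  define B where "B = sqrt K \<cdot>\<^sub>m C"
  have "B * B = K \<cdot>\<^sub>m (C * C)"
  proof (rule eq_matI)
    fix i j assume "i < dim_row (K \<cdot>\<^sub>m (C * C))" "j < dim_col (K \<cdot>\<^sub>m (C * C))"
    then have ij: "i < n" "j < n" using Cc by auto
    have sq: "sqrt K * a * (sqrt K * b) = K * (a * b)" for a b
      using K(1) by (simp add: mult.assoc mult.left_commute[of a] flip: mult.assoc[of "sqrt K" "sqrt K"])
    show "(B * B) $$ (i, j) = (K \<cdot>\<^sub>m (C * C)) $$ (i, j)"
      using Cc ij by (simp add: B_def scalar_prod_def sum_distrib_left sq)
  qed (use Cc in \<open>auto simp: B_def\<close>)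
  also have "\<dots> = A" using CA K A by (auto intro!: eq_matI)
  finally have "B * B = A" .
  moreover have "psd_mat n B"
    using C K by (auto simp: psd_mat_def B_def transpose_smult_mat smult_mat_mult_vec
        intro!: mult_nonneg_nonneg)
  ultimately show ?thesis by blast
qed

lemma psd_mat_kernel:
  assumes psd: "psd_mat n A" and x: "x \<in> carrier_vec n" and "x \<bullet> (A *\<^sub>v x) = 0"
  shows "A *\<^sub>v x = 0\<^sub>v n"
proof -
  have "A \<in> carrier_mat n n" using psd by (simp add: psd_mat_def)
  moreover have "(A *\<^sub>v x) \<bullet> (A *\<^sub>v x) \<le> 0"
    using psd_mat_quadratic_bound[OF psd] x assms(3) by fastforce
  ultimately show ?thesis
    using x scalar_prod_self_nonneg[of "A *\<^sub>v x"] by (intro scalar_prod_self_eq_0) auto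
qed

text \<open>
  With \<open>D = B - C\<close> and \<open>S = B + C\<close>, the equation \<open>B\<^sup>2 = C\<^sup>2\<close> gives \<open>DS = -SD\<close>. So \<open>DSD\<close>, which is
  positive semidefinite, has trace zero, and \<open>D\<close> maps every basis vector into the common kernel of
  \<open>B\<close> and \<open>C\<close>.
\<close>

lemma psd_sqrt_unique:
  assumes psdB: "psd_mat n B" and psdC: "psd_mat n C" and eq: "B * B = C * C"
  shows "B = C"
proof -
  have B: "B \<in> carrier_mat n n" "transpose_mat B = B" and C: "C \<in> carrier_mat n n" "transpose_mat C = C"
    using psdB psdC by (auto simp: psd_mat_def)
  define D where "D = B - C"
  define S where "S = B + C"
  have D: "D \<in> carrier_mat n n" "transpose_mat D = D"
    using B C by (auto simp: D_def transpose_minus[of _ n n])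
  have S: "S \<in> carrier_mat n n" using B C by (simp add: S_def)
  have eq': "(\<Sum>k<n. B $$ (i, k) * B $$ (k, j)) = (\<Sum>k<n. C $$ (i, k) * C $$ (k, j))"
    if "i < n" "j < n" for i j
    using arg_cong[OF eq, of "\<lambda>M. M $$ (i, j)"] that B C by (simp add: scalar_prod_def atLeast0LessThan)
  have anti: "(D * S) $$ (i, j) = - (S * D) $$ (i, j)" if "i < n" "j < n" for i j
  proof -
    have "(D * S) $$ (i, j) + (S * D) $$ (i, j)
        = 2 * ((\<Sum>k<n. B $$ (i, k) * B $$ (k, j)) - (\<Sum>k<n. C $$ (i, k) * C $$ (k, j)))"
      using that B C by (simp add: D_def S_def scalar_prod_def atLeast0LessThan algebra_simps
          sum.distrib sum_subtractf)
    then show ?thesis using eq'[OF that] by simp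
  qed
  define d where "d i = D *\<^sub>v unit_vec n i" for i
  have d: "d i \<in> carrier_vec n" for i using D by (simp add: d_def)
  have quad: "d i \<bullet> (S *\<^sub>v d i) = d i \<bullet> (B *\<^sub>v d i) + d i \<bullet> (C *\<^sub>v d i)" for i
    using B C d[of i] by (simp add: S_def add_mult_distrib_mat_vec[of _ n n] scalar_prod_add_distrib[of _ n])
  have nonneg: "0 \<le> d i \<bullet> (B *\<^sub>v d i)" "0 \<le> d i \<bullet> (C *\<^sub>v d i)" for i
    using psdB psdC d by (auto simp: psd_mat_def)
  have diag: "d i \<bullet> (S *\<^sub>v d i) = (\<Sum>k<n. (D * S) $$ (i, k) * D $$ (k, i))" if i: "i < n" for i
  proof -
    have "d i \<bullet> (S *\<^sub>v d i) = unit_vec n i \<bullet> (D *\<^sub>v (S *\<^sub>v d i))"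
      using symmetric_scalar_prod[OF D, of "unit_vec n i" "S *\<^sub>v d i"] S d by (simp add: d_def)
    also have "D *\<^sub>v (S *\<^sub>v d i) = (D * S * D) *\<^sub>v unit_vec n i"
      using D S by (simp add: d_def assoc_mult_mat_vec[of D n n "S * D" n] assoc_mult_mat_vec[of S n n D n])
    also have "unit_vec n i \<bullet> \<dots> = (D * S * D) $$ (i, i)"
      using D S i by (intro index_eq_scalar_prod_unit_vec[symmetric, of _ n]) auto
    also have "\<dots> = (\<Sum>k<n. (D * S) $$ (i, k) * D $$ (k, i))"
      using D S i by (subst index_mult_mat) (auto simp: scalar_prod_def atLeast0LessThan)
    finally show ?thesis .
  qed
  \<comment> \<open>The left side is the trace of \<open>D * S * D\<close>. Anticommutation turns it
    into minus the trace of \<open>S * D * D\<close>, and cyclic rearrangement leads back to the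
    original trace with a minus sign.\<close>
  have "(\<Sum>i<n. d i \<bullet> (S *\<^sub>v d i)) = (\<Sum>i<n. \<Sum>k<n. (D * S) $$ (i, k) * D $$ (k, i))"
    using diag by (intro sum.cong) auto
  also have "\<dots> = (\<Sum>i<n. \<Sum>k<n. - ((S * D) $$ (i, k) * D $$ (k, i)))"
    using anti by (intro sum.cong) auto
  also have "\<dots> = (\<Sum>i<n. \<Sum>k<n. \<Sum>l<n. - (S $$ (i, l) * D $$ (l, k) * D $$ (k, i)))"
    using D S by (simp add: scalar_prod_def atLeast0LessThan sum_distrib_right sum_negf)
  also have "\<dots> = (\<Sum>k<n. \<Sum>l<n. \<Sum>i<n. - (S $$ (i, l) * D $$ (l, k) * D $$ (k, i)))"
    by (subst sum.swap, intro sum.cong refl sum.swap)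
  also have "\<dots> = (\<Sum>l<n. \<Sum>k<n. \<Sum>i<n. - (D $$ (l, k) * (D $$ (k, i) * S $$ (i, l))))"
    by (subst sum.swap) (simp add: mult_ac)
  also have "\<dots> = - (\<Sum>l<n. \<Sum>k<n. D $$ (l, k) * (D * S) $$ (k, l))"
    using D S by (simp add: scalar_prod_def atLeast0LessThan sum_distrib_left sum_negf)
  also have "\<dots> = - (\<Sum>k<n. \<Sum>l<n. (D * S) $$ (k, l) * D $$ (l, k))"
    by (subst sum.swap) (simp add: mult.commute)
  also have "\<dots> = - (\<Sum>i<n. d i \<bullet> (S *\<^sub>v d i))"
    using diag by simp
  finally have "(\<Sum>i<n. d i \<bullet> (S *\<^sub>v d i)) = 0" by simp
  then have zero: "d i \<bullet> (S *\<^sub>v d i) = 0" if "i < n" for i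
    using that nonneg by (subst (asm) sum_nonneg_eq_0_iff) (auto simp: quad add_nonneg_nonneg)
  have "d i = 0\<^sub>v n" if i: "i < n" for i
  proof -
    have "B *\<^sub>v d i = 0\<^sub>v n" "C *\<^sub>v d i = 0\<^sub>v n"
      using zero[OF i] nonneg[of i] quad[of i] psd_mat_kernel[OF psdB d] psd_mat_kernel[OF psdC d]
      by (auto simp: add_nonneg_eq_0_iff)
    then have "D *\<^sub>v d i = 0\<^sub>v n"
      using B C d[of i] by (simp add: D_def minus_mult_distrib_mat_vec[of _ n n])
    \<comment> \<open>\<open>D\<close> is symmetric, so the square norm of its column
      \<open>d i\<close> can be read off from \<open>D\<close> applied to that column, which is
      zero.\<close>
    moreover have "d i \<bullet> d i = unit_vec n i \<bullet> (D *\<^sub>v d i)"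
      using symmetric_scalar_prod[OF D, of "unit_vec n i" "d i"] d by (simp add: d_def)
    ultimately have "d i \<bullet> d i = 0" by simp
    then show ?thesis using d by (intro scalar_prod_self_eq_0)
  qed
  then have "D $$ (i, j) = 0" if "i < n" "j < n" for i j
    using index_eq_scalar_prod_unit_vec[OF D(1) that] that by (simp flip: d_def)
  then show ?thesis using B C by (intro eq_matI) (auto simp: D_def)
qed

lemma psd_sqrt_correct:
  assumes "psd_mat n A"
  shows "psd_mat n (psd_sqrt n A)" "psd_sqrt n A * psd_sqrt n A = A"
proof -
  have "\<exists>!B. psd_mat n B \<and> B * B = A"
    using psd_sqrt_exists[OF assms] psd_sqrt_unique by metis
  from theI'[OF this] show "psd_mat n (psd_sqrt n A)" "psd_sqrt n A * psd_sqrt n A = A"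
    unfolding psd_sqrt_def by auto
qed

subsection \<open>Rotation invariance of the Gaussian measure\<close>

lemma sum_lessThan_remove2:
  fixes h :: "nat \<Rightarrow> real"
  assumes "i < n" "j < n" "i \<noteq> j"
  shows "(\<Sum>k<n. h k) = h i + h j + (\<Sum>k\<in>{..<n} - {i, j}. h k)"
proof -
  have "(\<Sum>k<n. h k) = h i + (\<Sum>k\<in>{..<n} - {i}. h k)"
    using assms by (intro sum.remove) auto
  also have "(\<Sum>k\<in>{..<n} - {i}. h k) = h j + (\<Sum>k\<in>{..<n} - {i} - {j}. h k)"
    using assms by (intro sum.remove) auto
  finally show ?thesis by (simp add: Diff_insert2[symmetric] insert_commute add.assoc)
qed

lemma measurable_inner_on [measurable]:
  assumes [measurable]: "\<And>i. i < n \<Longrightarrow> (\<lambda>z. f z i) \<in> borel_measurable M"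
    "\<And>i. i < n \<Longrightarrow> (\<lambda>z. g z i) \<in> borel_measurable M"
  shows "(\<lambda>z. inner_on n (f z) (g z)) \<in> borel_measurable M"
  unfolding inner_on_def by measurable

text \<open>Fubini integrates coordinate \<open>j\<close> first; with the other coordinates fixed,
  \<open>g x\<close> is a constant and the substitution is affine on the real line. Suitable
  \<open>g\<close> and \<open>d\<close> give every change of variables used later: shears, sign
  flips and the scaling of one coordinate.\<close>

lemma nn_integral_PiM_lborel_affine_update:
  fixes f :: "('i \<Rightarrow> real) \<Rightarrow> ennreal" and d :: real
  assumes I: "finite I" "j \<in> I" and d: "d \<noteq> 0"
    and f[measurable]: "f \<in> borel_measurable (Pi\<^sub>M I (\<lambda>_. lborel))"
    and g[measurable]: "g \<in> borel_measurable (Pi\<^sub>M I (\<lambda>_. lborel))"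
    and g_upd: "\<And>x y. g (x(j := y)) = g x"
  shows "(\<integral>\<^sup>+x. f x \<partial>Pi\<^sub>M I (\<lambda>_. lborel))
    = ennreal \<bar>d\<bar> * (\<integral>\<^sup>+x. f (x(j := g x + d * x j)) \<partial>Pi\<^sub>M I (\<lambda>_. lborel))"
proof -
  interpret product_sigma_finite "\<lambda>_ :: 'i. lborel :: real measure" ..
  define J where "J = I - {j}"
  have J: "finite J" "j \<notin> J" and IJ: "I = insert j J" using I by (auto simp: J_def)
  let ?L = "\<lambda>I. Pi\<^sub>M I (\<lambda>_ :: 'i. lborel :: real measure)"
  have upd: "(\<lambda>y. f (x(j := y))) \<in> borel_measurable borel" if "x \<in> space (?L J)" for x
    using measurable_comp[OF measurable_component_update[OF that J(2)] f[unfolded IJ]]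
    by (simp add: comp_def)
  have meas: "(\<lambda>x. x(j := g x + d * x j)) \<in> ?L I \<rightarrow>\<^sub>M ?L I"
    by (rule measurable_fun_upd[of I I]) (use I in \<open>auto simp: insert_absorb\<close>)
  have "(\<integral>\<^sup>+x. f x \<partial>?L I) = (\<integral>\<^sup>+x. (\<integral>\<^sup>+y. f (x(j := y)) \<partial>lborel) \<partial>?L J)"
    unfolding IJ by (rule product_nn_integral_insert[OF J]) (use f IJ in simp)
  also have "\<dots> = (\<integral>\<^sup>+x. ennreal \<bar>d\<bar> * (\<integral>\<^sup>+y. f (x(j := g x + d * y)) \<partial>lborel) \<partial>?L J)"
    by (intro nn_integral_cong nn_integral_real_affine upd d)
  also have "\<dots> = (\<integral>\<^sup>+x. (\<integral>\<^sup>+y. ennreal \<bar>d\<bar> * f (x(j := g x + d * y)) \<partial>lborel) \<partial>?L J)"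
  proof (intro nn_integral_cong nn_integral_cmult[symmetric])
    fix x assume "x \<in> space (?L J)"
    from measurable_compose[OF _ upd[OF this], of "\<lambda>y. g x + d * y" lborel]
    show "(\<lambda>y. f (x(j := g x + d * y))) \<in> borel_measurable lborel" by simp
  qed
  also have "\<dots> = (\<integral>\<^sup>+x. ennreal \<bar>d\<bar> * f (x(j := g x + d * x j)) \<partial>?L I)"
    unfolding IJ using measurable_compose[OF meas f]
    by (subst product_nn_integral_insert[OF J]) (simp_all add: IJ g_upd)
  also have "\<dots> = ennreal \<bar>d\<bar> * (\<integral>\<^sup>+x. f (x(j := g x + d * x j)) \<partial>?L I)"
    by (intro nn_integral_cmult measurable_compose[OF meas f])
  finally show ?thesis .
qed

lemma std_gaussian_density:
  "std_gaussian n = density (\<Pi>\<^sub>M i\<in>{..<n}. lborel)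
     (\<lambda>z. ennreal ((1 / sqrt (2 * pi)) ^ n * exp (- inner_on n z z / 2)))"
proof -
  interpret L: product_sigma_finite "\<lambda>_ :: nat. lborel :: real measure" ..
  interpret G: product_prob_space "\<lambda>_ :: nat. std_normal_distribution"
    by (intro product_prob_spaceI prob_space_normal_density) auto
  have dens: "ennreal ((1 / sqrt (2 * pi)) ^ n * exp (- inner_on n z z / 2))
      = (\<Prod>i<n. ennreal (std_normal_density (z i)))" for z
  proof -
    have "- inner_on n z z / 2 = (\<Sum>i<n. - (z i)\<^sup>2 / 2)"
      by (simp add: inner_on_def power2_eq_square sum_negf sum_divide_distrib)
    then have "(\<Prod>i<n. std_normal_density (z i)) = (1 / sqrt (2 * pi)) ^ n * exp (- inner_on n z z / 2)"
      unfolding std_normal_density_def prod.distrib by (simp add: exp_sum)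
    then show ?thesis by (simp add: prod_ennreal)
  qed
  show ?thesis
    unfolding std_gaussian_def dens
  proof (rule G.PiM_eqI[symmetric])
    show "sets (density (\<Pi>\<^sub>M i\<in>{..<n}. lborel) (\<lambda>z. \<Prod>i<n. ennreal (std_normal_density (z i))))
        = sets (\<Pi>\<^sub>M i\<in>{..<n}. std_normal_distribution)"
      by (simp cong: sets_PiM_cong)
    fix A :: "nat \<Rightarrow> real set" assume A: "\<And>i. i \<in> {..<n} \<Longrightarrow> A i \<in> sets std_normal_distribution"
    then have A'[measurable]: "i < n \<Longrightarrow> A i \<in> sets borel" for i by simp
    have "emeasure (density (\<Pi>\<^sub>M i\<in>{..<n}. lborel) (\<lambda>z. \<Prod>i<n. ennreal (std_normal_density (z i)))) (Pi\<^sub>E {..<n} A)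
        = (\<integral>\<^sup>+z. (\<Prod>i<n. ennreal (std_normal_density (z i))) * indicator (Pi\<^sub>E {..<n} A) z \<partial>(\<Pi>\<^sub>M i\<in>{..<n}. lborel))"
      using A' by (intro emeasure_density sets_PiM_I_finite) auto
    also have "\<dots> = (\<integral>\<^sup>+z. (\<Prod>i<n. ennreal (std_normal_density (z i)) * indicator (A i) (z i)) \<partial>(\<Pi>\<^sub>M i\<in>{..<n}. lborel))"
    proof (intro nn_integral_cong)
      fix z assume "z \<in> space (\<Pi>\<^sub>M i\<in>{..<n}. lborel :: real measure)"
      then have "indicator (Pi\<^sub>E {..<n} A) z = (\<Prod>i<n. indicator (A i) (z i) :: ennreal)"
        by (auto simp: space_PiM PiE_iff indicator_def split: if_splits)
      then show "(\<Prod>i<n. ennreal (std_normal_density (z i))) * indicator (Pi\<^sub>E {..<n} A) z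
          = (\<Prod>i<n. ennreal (std_normal_density (z i)) * indicator (A i) (z i))"
        by (simp add: prod.distrib)
    qed
    also have "\<dots> = (\<Prod>i<n. \<integral>\<^sup>+z. ennreal (std_normal_density z) * indicator (A i) z \<partial>lborel)"
      by (rule L.product_nn_integral_prod) auto
    also have "\<dots> = (\<Prod>i<n. emeasure std_normal_distribution (A i))"
      using A' by (intro prod.cong) (auto simp: emeasure_density)
    finally show "emeasure (density (\<Pi>\<^sub>M i\<in>{..<n}. lborel) (\<lambda>z. \<Prod>i<n. ennreal (std_normal_density (z i)))) (Pi\<^sub>E {..<n} A)
        = (\<Prod>i<n. emeasure std_normal_distribution (A i))" .
  qed simp
qed

lemma sets_std_gaussian [measurable_cong]: "sets (std_gaussian n) = sets (\<Pi>\<^sub>M i\<in>{..<n}. lborel)"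
  by (simp add: std_gaussian_density)

lemma nn_integral_std_gaussian:
  assumes "f \<in> borel_measurable (\<Pi>\<^sub>M i\<in>{..<n}. lborel)"
  shows "(\<integral>\<^sup>+z. f z \<partial>std_gaussian n)
    = (\<integral>\<^sup>+z. ennreal ((1 / sqrt (2 * pi)) ^ n * exp (- inner_on n z z / 2)) * f z
        \<partial>(\<Pi>\<^sub>M i\<in>{..<n}. lborel))"
  unfolding std_gaussian_density by (rule nn_integral_density[OF _ assms]) measurable

section \<open>Plane rotations and sign flips of Gaussian vectors\<close>

definition givens :: "nat \<Rightarrow> nat \<Rightarrow> real \<Rightarrow> real \<Rightarrow> (nat \<Rightarrow> real) \<Rightarrow> nat \<Rightarrow> real" where
  "givens i j c s x = x(i := c * x i - s * x j, j := s * x i + c * x j)"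

lemma inner_on_givens:
  assumes "i < n" "j < n" "i \<noteq> j" "c\<^sup>2 + s\<^sup>2 = 1"
  shows "inner_on n (givens i j c s x) (givens i j c s y) = inner_on n x y"
proof -
  have "(c * x i - s * x j) * (c * y i - s * y j) + (s * x i + c * x j) * (s * y i + c * y j)
      = (c\<^sup>2 + s\<^sup>2) * (x i * y i + x j * y j)"
    by (simp add: algebra_simps power2_eq_square)
  then have *: "(c * x i - s * x j) * (c * y i - s * y j) + (s * x i + c * x j) * (s * y i + c * y j)
      = x i * y i + x j * y j"
    using assms(4) by simp
  show ?thesis
    using assms(3) * unfolding inner_on_def givens_def sum_lessThan_remove2[OF assms(1-3)] by simp
qed

text \<open>A rotation other than \<open>x \<mapsto> \<plusminus> x\<close> is a product of three shears, and these preserve Lebesgue measure.\<close>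

lemma nn_integral_std_gaussian_givens:
  assumes ij: "i < n" "j < n" "i \<noteq> j" and cs: "c\<^sup>2 + s\<^sup>2 = 1" and s: "s \<noteq> 0"
    and f[measurable]: "f \<in> borel_measurable (\<Pi>\<^sub>M i\<in>{..<n}. lborel)"
  shows "(\<integral>\<^sup>+z. f (givens i j c s z) \<partial>std_gaussian n) = (\<integral>\<^sup>+z. f z \<partial>std_gaussian n)"
proof -
  let ?L = "\<Pi>\<^sub>M i\<in>{..<n}. lborel :: real measure"
  define sh where "sh i j a x = x(i := a * x j + 1 * x i)" for i j :: nat and a :: real and x :: "nat \<Rightarrow> real"
  have sh_meas[measurable]: "sh i j a \<in> ?L \<rightarrow>\<^sub>M ?L" if "i < n" "j < n" for i j a
    unfolding sh_def by (rule measurable_fun_upd[of "{..<n}" "{..<n}"]) (use that in auto)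
  have sh: "(\<integral>\<^sup>+x. h (sh i j a x) \<partial>?L) = (\<integral>\<^sup>+x. h x \<partial>?L)"
    if "i < n" "j < n" "i \<noteq> j" "h \<in> borel_measurable ?L" for i j a h
    using that nn_integral_PiM_lborel_affine_update[of "{..<n}" i 1 h "\<lambda>x. a * x j"]
    by (simp add: sh_def)
  \<comment> \<open>If \<open>c\<close> and \<open>s\<close> are the cosine and sine of an angle,
    then \<open>p\<close> is minus the tangent of half of it, the factor of the two outer
    shears.\<close>
  define p where "p = (c - 1) / s"
  have ps: "p * s = c - 1" using s by (simp add: p_def)
  have pc: "p * c + p = - s"
  proof -
    have "s * (p * c + p) = (p * s) * (c + 1)" by (simp add: algebra_simps)
    also have "\<dots> = s * (- s)" using cs by (simp add: ps algebra_simps power2_eq_square)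
    finally have "s * (p * c + p) = s * (- s)" .
    then show ?thesis using mult_left_cancel[OF s, of "p * c + p" "- s"] by blast
  qed
  have giv: "givens i j c s x = sh i j p (sh j i s (sh i j p x))" for x
  proof
    fix k
    have "s * (p * x j + x i) + x j = s * x i + (p * s + 1) * x j" by (simp add: algebra_simps)
    then have *: "s * (p * x j + x i) + x j = s * x i + c * x j" by (simp add: ps)
    have "p * (s * x i + c * x j) + (p * x j + x i) = (p * s + 1) * x i + (p * c + p) * x j"
      by (simp add: algebra_simps)
    then have "p * (s * x i + c * x j) + (p * x j + x i) = c * x i - s * x j"
      by (simp add: ps pc)
    then show "givens i j c s x k = sh i j p (sh j i s (sh i j p x)) k"
      using ij(3) by (simp add: givens_def sh_def *)
  qed
  have [measurable]: "givens i j c s \<in> ?L \<rightarrow>\<^sub>M ?L"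
    using ij unfolding giv by measurable
  define g where "g = (\<lambda>z. ennreal ((1 / sqrt (2 * pi)) ^ n * exp (- inner_on n z z / 2)) * f z)"
  have g[measurable]: "g \<in> borel_measurable ?L" unfolding g_def by measurable
  have "(\<integral>\<^sup>+z. f (givens i j c s z) \<partial>std_gaussian n) = (\<integral>\<^sup>+z. g (givens i j c s z) \<partial>?L)"
    by (subst nn_integral_std_gaussian) (simp_all add: g_def inner_on_givens[OF ij cs])
  also have "\<dots> = (\<integral>\<^sup>+z. g z \<partial>?L)"
    unfolding giv using ij by (simp add: sh sh[where h="\<lambda>x. g (sh i j p x)"]
        sh[where h="\<lambda>x. g (sh i j p (sh j i s x))"])
  also have "\<dots> = (\<integral>\<^sup>+z. f z \<partial>std_gaussian n)"
    by (subst nn_integral_std_gaussian) (simp_all add: g_def)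
  finally show ?thesis .
qed

lemma nn_integral_std_gaussian_flip:
  assumes i: "i < n" and f[measurable]: "f \<in> borel_measurable (\<Pi>\<^sub>M i\<in>{..<n}. lborel)"
  shows "(\<integral>\<^sup>+z. f (z(i := - z i)) \<partial>std_gaussian n) = (\<integral>\<^sup>+z. f z \<partial>std_gaussian n)"
proof -
  let ?L = "\<Pi>\<^sub>M i\<in>{..<n}. lborel :: real measure"
  have [measurable]: "(\<lambda>z. z(i := - z i)) \<in> ?L \<rightarrow>\<^sub>M ?L"
    by (rule measurable_fun_upd[of "{..<n}" "{..<n}"]) (use i in auto)
  define g where "g = (\<lambda>z. ennreal ((1 / sqrt (2 * pi)) ^ n * exp (- inner_on n z z / 2)) * f z)"
  have g[measurable]: "g \<in> borel_measurable ?L" unfolding g_def by measurable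
  have "inner_on n (z(i := - z i)) (z(i := - z i)) = inner_on n z z" for z
    unfolding inner_on_def by (intro sum.cong) auto
  then have "(\<integral>\<^sup>+z. f (z(i := - z i)) \<partial>std_gaussian n) = (\<integral>\<^sup>+z. g (z(i := - z i)) \<partial>?L)"
    by (subst nn_integral_std_gaussian) (simp_all add: g_def)
  also have "\<dots> = (\<integral>\<^sup>+z. g z \<partial>?L)"
    using nn_integral_PiM_lborel_affine_update[of "{..<n}" i "-1" g "\<lambda>_. 0"] i by simp
  also have "\<dots> = (\<integral>\<^sup>+z. f z \<partial>std_gaussian n)"
    by (subst nn_integral_std_gaussian) (simp_all add: g_def)
  finally show ?thesis .
qed

text \<open>Rotations in the planes of \<open>i\<close> and \<open>j\<close> clear the entries
  \<open>j\<close> in \<open>J\<close> of \<open>e\<close> one at a time. Rotating \<open>e\<close>,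
  \<open>f\<close> and the Gaussian vector together preserves all inner products. Fixing the entries
  outside \<open>insert i J\<close> is what lets a second elimination, with another pivot, keep
  entry 0 of both vectors.\<close>

lemma nn_integral_gaussian_pair_eliminate:
  fixes F :: "real \<Rightarrow> real \<Rightarrow> ennreal"
  assumes F[measurable]: "case_prod F \<in> borel_measurable (borel \<Otimes>\<^sub>M borel)"
    and J: "finite J" "J \<subseteq> {..<n} - {i}" and i: "i < n"
  shows "\<exists>e' f'. (\<integral>\<^sup>+z. F (inner_on n e z) (inner_on n f z) \<partial>std_gaussian n)
        = (\<integral>\<^sup>+z. F (inner_on n e' z) (inner_on n f' z) \<partial>std_gaussian n)
      \<and> (\<forall>k\<in>J. e' k = 0) \<and> (\<forall>k. k \<notin> insert i J \<longrightarrow> e' k = e k \<and> f' k = f k)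
      \<and> inner_on n e' e' = inner_on n e e \<and> inner_on n e' f' = inner_on n e f
      \<and> inner_on n f' f' = inner_on n f f"
  using J
proof (induction J rule: finite_induct)
  case empty
  show ?case by (rule exI[of _ e], rule exI[of _ f]) auto
next
  case (insert j J)
  then obtain e' f' where
    eq: "(\<integral>\<^sup>+z. F (inner_on n e z) (inner_on n f z) \<partial>std_gaussian n)
        = (\<integral>\<^sup>+z. F (inner_on n e' z) (inner_on n f' z) \<partial>std_gaussian n)"
    and zero: "\<forall>k\<in>J. e' k = 0" and same: "\<forall>k. k \<notin> insert i J \<longrightarrow> e' k = e k \<and> f' k = f k"
    and inner: "inner_on n e' e' = inner_on n e e" "inner_on n e' f' = inner_on n e f"
      "inner_on n f' f' = inner_on n f f"
    by auto
  have ij: "i < n" "j < n" "i \<noteq> j" using i insert.prems by auto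
  show ?case
  proof (cases "e' j = 0")
    case True
    show ?thesis
      by (rule exI[of _ e'], rule exI[of _ f']) (use True eq zero same inner in auto)
  next
    case False
    \<comment> \<open>The rotation sends the pair of entries \<open>e' i\<close>,
      \<open>e' j\<close> to \<open>h\<close>, \<open>0\<close>. The case \<open>e' j = 0\<close>
      was split off because it would give \<open>s = 0\<close>, which the invariance lemma
      excludes.\<close>
    define h where "h = sqrt ((e' i)\<^sup>2 + (e' j)\<^sup>2)"
    have h2: "h\<^sup>2 = (e' i)\<^sup>2 + (e' j)\<^sup>2" by (simp add: h_def)
    have h: "h \<noteq> 0" using False h2 by (auto simp: sum_power2_eq_zero_iff)
    define c where "c = e' i / h"
    define s where "s = - e' j / h"
    have cs: "c\<^sup>2 + s\<^sup>2 = 1" using h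
      by (simp add: c_def s_def power_divide flip: add_divide_distrib h2)
    have s: "s \<noteq> 0" using False h by (simp add: s_def)
    let ?G = "givens i j c s"
    have "(\<integral>\<^sup>+z. F (inner_on n e' z) (inner_on n f' z) \<partial>std_gaussian n)
        = (\<integral>\<^sup>+z. F (inner_on n (?G e') (?G z)) (inner_on n (?G f') (?G z)) \<partial>std_gaussian n)"
      by (simp add: inner_on_givens[OF ij cs])
    also have "\<dots> = (\<integral>\<^sup>+z. F (inner_on n (?G e') z) (inner_on n (?G f') z) \<partial>std_gaussian n)"
      by (rule nn_integral_std_gaussian_givens[OF ij cs s]) measurable
    finally have eqG: "(\<integral>\<^sup>+z. F (inner_on n e z) (inner_on n f z) \<partial>std_gaussian n)
        = (\<integral>\<^sup>+z. F (inner_on n (?G e') z) (inner_on n (?G f') z) \<partial>std_gaussian n)"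
      using eq by simp
    have Gj: "?G e' j = 0" by (simp add: givens_def c_def s_def)
    have Gk: "?G e' k = e' k \<and> ?G f' k = f' k" if "k \<noteq> i" "k \<noteq> j" for k
      using that by (simp add: givens_def)
    have zero': "\<forall>k\<in>insert j J. ?G e' k = 0"
    proof
      fix k assume "k \<in> insert j J"
      moreover have "i \<notin> J" using insert.prems by auto
      ultimately show "?G e' k = 0" using Gj Gk[of k] zero by (cases "k = j") auto
    qed
    have same': "\<forall>k. k \<notin> insert i (insert j J) \<longrightarrow> ?G e' k = e k \<and> ?G f' k = f k"
      using Gk same by simp
    show ?thesis
      by (rule exI[of _ "?G e'"], rule exI[of _ "?G f'"])
        (intro conjI eqG zero' same', simp_all add: inner_on_givens[OF ij cs] inner)
  qed
qed

lemma inner_on_eq_single: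
  assumes "i < n" "\<And>k. k < n \<Longrightarrow> k \<noteq> i \<Longrightarrow> x k = 0"
  shows "inner_on n x y = x i * y i"
  unfolding inner_on_def using assms by (subst sum.remove[of _ i]) auto

text \<open>Elimination turns \<open>e\<close> into plus or minus the first basis vector.
  Orthogonality then confines \<open>f\<close> to the remaining coordinates, where a second
  elimination turns it into plus or minus the second one. Sign flips remove the two signs.\<close>

lemma nn_integral_gaussian_orthonormal_pair:
  fixes F :: "real \<Rightarrow> real \<Rightarrow> ennreal"
  assumes F[measurable]: "case_prod F \<in> borel_measurable (borel \<Otimes>\<^sub>M borel)"
    and n: "2 \<le> n"
    and ortho: "inner_on n e e = 1" "inner_on n f f = 1" "inner_on n e f = 0"
  shows "(\<integral>\<^sup>+z. F (inner_on n e z) (inner_on n f z) \<partial>std_gaussian n)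
    = (\<integral>\<^sup>+z. F (z 0) (z 1) \<partial>std_gaussian n)"
proof -
  have ltn: "0 < n" "1 < n" using n by auto
  obtain e1 f1 where 1:
    "(\<integral>\<^sup>+z. F (inner_on n e z) (inner_on n f z) \<partial>std_gaussian n)
      = (\<integral>\<^sup>+z. F (inner_on n e1 z) (inner_on n f1 z) \<partial>std_gaussian n)"
    "\<forall>k\<in>{1..<n}. e1 k = 0" "inner_on n e1 e1 = 1" "inner_on n e1 f1 = 0" "inner_on n f1 f1 = 1"
  proof -
    have "{1..<n} \<subseteq> {..<n} - {0}" by auto
    from nn_integral_gaussian_pair_eliminate[OF F _ this ltn(1), of e f] ortho that
    show ?thesis by auto
  qed
  have e1: "inner_on n e1 y = e1 0 * y 0" for y
    using 1(2) n by (intro inner_on_eq_single) auto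
  have "e1 0 * e1 0 = 1" "f1 0 = 0" using 1 e1 by auto
  \<comment> \<open>The vectors exchange roles, with the arguments of \<open>F\<close> swapped.
    Pivot 1 and the cleared set \<open>{2..<n}\<close> leave entry 0 of both untouched.\<close>
  obtain f2 e2 where 2:
    "(\<integral>\<^sup>+z. F (inner_on n e1 z) (inner_on n f1 z) \<partial>std_gaussian n)
      = (\<integral>\<^sup>+z. F (inner_on n e2 z) (inner_on n f2 z) \<partial>std_gaussian n)"
    "\<forall>k\<in>{2..<n}. f2 k = 0" "f2 0 = f1 0" "e2 0 = e1 0"
    "inner_on n f2 f2 = 1" "inner_on n f2 e2 = 0" "inner_on n e2 e2 = 1"
  proof -
    have sub: "{2..<n} \<subseteq> {..<n} - {1}" by auto
    have "inner_on n f1 e1 = 0" using 1 by (simp add: inner_on_def mult.commute)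
    moreover have "(\<lambda>(y, x). F x y) \<in> borel_measurable (borel \<Otimes>\<^sub>M borel)" by measurable
    ultimately show ?thesis
      using nn_integral_gaussian_pair_eliminate[of "\<lambda>y x. F x y" "{2..<n}" n 1 f1 e1] sub ltn 1 that by auto
  qed
  have f2: "inner_on n f2 y = f2 1 * y 1" for y
  proof (intro inner_on_eq_single)
    fix k assume "k < n" "k \<noteq> 1"
    then show "f2 k = 0" using 2 \<open>f1 0 = 0\<close> by (cases "k = 0") auto
  qed (use n in auto)
  have f2sq: "f2 1 * f2 1 = 1" using 2(5) f2 by simp
  have e2sq: "e2 0 * e2 0 = 1" using 2(4) \<open>e1 0 * e1 0 = 1\<close> by simp
  \<comment> \<open>The elimination lemma does not track the entries of \<open>e2\<close> from 1 on;
    they vanish because \<open>e2\<close> has norm 1 and its entry 0 already has square 1.\<close>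
  have "(\<Sum>k\<in>{..<n} - {0}. e2 k * e2 k) = 0"
    using 2(7) e2sq ltn by (simp add: inner_on_def sum.remove[of _ "0::nat"])
  then have "\<forall>k\<in>{..<n} - {0}. e2 k * e2 k = 0" by (subst (asm) sum_nonneg_eq_0_iff) auto
  then have e2: "inner_on n e2 y = e2 0 * y 0" for y
    using ltn by (intro inner_on_eq_single) auto
  define p where "p = e2 0"
  define q where "q = f2 1"
  have pq: "p = 1 \<or> p = - 1" "q = 1 \<or> q = - 1"
    using f2sq e2sq by (auto simp: p_def q_def square_eq_1_iff)
  have flip0: "(\<integral>\<^sup>+z. F (- z 0) (a * z 1) \<partial>std_gaussian n) = (\<integral>\<^sup>+z. F (z 0) (a * z 1) \<partial>std_gaussian n)" for a
    using nn_integral_std_gaussian_flip[OF ltn(1), of "\<lambda>z. F (z 0) (a * z 1)"] ltn by simp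
  have flip1: "(\<integral>\<^sup>+z. F (z 0) (- z 1) \<partial>std_gaussian n) = (\<integral>\<^sup>+z. F (z 0) (z 1) \<partial>std_gaussian n)"
    using nn_integral_std_gaussian_flip[OF ltn(2), of "\<lambda>z. F (z 0) (z 1)"] ltn by simp
  have "(\<integral>\<^sup>+z. F (p * z 0) (q * z 1) \<partial>std_gaussian n) = (\<integral>\<^sup>+z. F (z 0) (z 1) \<partial>std_gaussian n)"
    using pq flip0[of 1] flip0[of "-1"] flip1 by auto
  then show ?thesis using 1(1) 2(1) by (simp add: e2 f2 p_def q_def)
qed

subsection \<open>Independence of norm and direction\<close>

text \<open>Entries from \<open>n\<close> on are kept, so that functions extensional on
  \<open>{..<n}\<close> stay extensional and a smaller bound scales just an initial block of
  coordinates.\<close>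

abbreviation scale_on :: "nat \<Rightarrow> real \<Rightarrow> (nat \<Rightarrow> real) \<Rightarrow> nat \<Rightarrow> real" where
  "scale_on n r x \<equiv> (\<lambda>i. if i < n then r * x i else x i)"

lemma norm_on_nonneg [simp]: "0 \<le> norm_on n x"
  by (auto simp: norm_on_def inner_on_def intro!: sum_nonneg)

lemma norm_on_power2: "(norm_on n x)\<^sup>2 = inner_on n x x"
  unfolding norm_on_def by (intro real_sqrt_pow2) (auto simp: inner_on_def intro!: sum_nonneg)

lemma norm_on_scale:
  assumes "0 \<le> r"
  shows "norm_on n (scale_on n r x) = r * norm_on n x"
proof -
  have "inner_on n (scale_on n r x) (scale_on n r x) = r\<^sup>2 * inner_on n x x"
    by (simp add: inner_on_def sum_distrib_left power2_eq_square mult_ac)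
  then show ?thesis using assms by (simp add: norm_on_def real_sqrt_mult)
qed

lemma measurable_norm_on [measurable]:
  assumes [measurable]: "\<And>i. i < n \<Longrightarrow> (\<lambda>z. f z i) \<in> borel_measurable M"
  shows "(\<lambda>z. norm_on n (f z)) \<in> borel_measurable M"
  unfolding norm_on_def by measurable

text \<open>Each induction step scales one more coordinate, an affine update with factor
  \<open>r\<close>. Measurability is carried along because the next update applies to the composed
  function.\<close>

lemma nn_integral_PiM_lborel_scale:
  fixes r :: real
  assumes r: "0 < r" and f[measurable]: "f \<in> borel_measurable (\<Pi>\<^sub>M i\<in>{..<n}. lborel)"
  shows "(\<integral>\<^sup>+x. f x \<partial>(\<Pi>\<^sub>M i\<in>{..<n}. lborel))
    = ennreal (r ^ n) * (\<integral>\<^sup>+x. f (scale_on n r x) \<partial>(\<Pi>\<^sub>M i\<in>{..<n}. lborel))"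
    and measurable_scale_on: "scale_on n r \<in> (\<Pi>\<^sub>M i\<in>{..<n}. lborel) \<rightarrow>\<^sub>M (\<Pi>\<^sub>M i\<in>{..<n}. lborel)"
proof -
  let ?L = "\<Pi>\<^sub>M i\<in>{..<n}. lborel :: real measure"
  have "(\<integral>\<^sup>+x. f x \<partial>?L) = ennreal (r ^ m) * (\<integral>\<^sup>+x. f (scale_on m r x) \<partial>?L)
      \<and> scale_on m r \<in> ?L \<rightarrow>\<^sub>M ?L" if "m \<le> n" for m
    using that
  proof (induction m)
    case (Suc m)
    then have m: "m < n" by simp
    have IH: "(\<integral>\<^sup>+x. f x \<partial>?L) = ennreal (r ^ m) * (\<integral>\<^sup>+x. f (scale_on m r x) \<partial>?L)"
      and meas[measurable]: "scale_on m r \<in> ?L \<rightarrow>\<^sub>M ?L" using Suc by auto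
    have eq: "scale_on m r (x(m := 0 + r * x m)) = scale_on (Suc m) r x" for x
      by (auto simp: less_Suc_eq)
    have upd[measurable]: "(\<lambda>x. x(m := 0 + r * x m)) \<in> ?L \<rightarrow>\<^sub>M ?L"
      by (rule measurable_fun_upd[of "{..<n}" "{..<n}"]) (use m in auto)
    have "(\<integral>\<^sup>+x. f (scale_on m r x) \<partial>?L)
        = ennreal \<bar>r\<bar> * (\<integral>\<^sup>+x. f (scale_on m r (x(m := 0 + r * x m))) \<partial>?L)"
      by (rule nn_integral_PiM_lborel_affine_update) (use m r in auto)
    then have "(\<integral>\<^sup>+x. f x \<partial>?L) = ennreal (r ^ Suc m) * (\<integral>\<^sup>+x. f (scale_on (Suc m) r x) \<partial>?L)"
      unfolding eq IH using r by (simp add: ennreal_mult mult_ac)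
    moreover have "scale_on (Suc m) r \<in> ?L \<rightarrow>\<^sub>M ?L"
      using measurable_compose[OF upd meas] unfolding eq .
    ultimately show ?case by blast
  qed simp
  from this[of n] show "(\<integral>\<^sup>+x. f x \<partial>?L) = ennreal (r ^ n) * (\<integral>\<^sup>+x. f (scale_on n r x) \<partial>?L)"
    "scale_on n r \<in> ?L \<rightarrow>\<^sub>M ?L" by auto
qed

lemma emeasure_cone_cball:
  assumes n: "1 \<le> n" and r: "0 \<le> r"
    and C[measurable]: "C \<in> sets (\<Pi>\<^sub>M i\<in>{..<n}. lborel)"
    and cone: "\<And>r x. 0 < r \<Longrightarrow> scale_on n r x \<in> C \<longleftrightarrow> x \<in> C"
  shows "emeasure (\<Pi>\<^sub>M i\<in>{..<n}. lborel) {x \<in> C. norm_on n x \<le> r}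
    = ennreal (r ^ n) * emeasure (\<Pi>\<^sub>M i\<in>{..<n}. lborel) {x \<in> C. norm_on n x \<le> 1}"
proof -
  let ?L = "\<Pi>\<^sub>M i\<in>{..<n}. lborel :: real measure"
  interpret L: product_sigma_finite "\<lambda>_ :: nat. lborel :: real measure" ..
  have sets[measurable]: "{x \<in> C. norm_on n x \<le> r} \<in> sets ?L" for r
  proof -
    have "{x \<in> C. norm_on n x \<le> r} = C \<inter> {x \<in> space ?L. norm_on n x \<le> r}"
      using sets.sets_into_space[OF C] by auto
    then show ?thesis by simp
  qed
  show ?thesis
  proof (cases "r = 0")
    \<comment> \<open>A ball of radius 0 contains at most the origin, a null set because
      \<open>n\<close> is positive; for the same reason \<open>0 ^ n\<close> is 0.\<close>
    case True
    have "{x \<in> C. norm_on n x \<le> 0} \<subseteq> (\<Pi>\<^sub>E i\<in>{..<n}. {0})"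
    proof
      fix x assume x: "x \<in> {x \<in> C. norm_on n x \<le> 0}"
      then have "(norm_on n x)\<^sup>2 = 0" using norm_on_nonneg[of n x] by simp
      then have "\<forall>i<n. x i * x i = 0"
        unfolding norm_on_power2 inner_on_def by (subst (asm) sum_nonneg_eq_0_iff) auto
      moreover have "x \<in> space ?L" using x sets.sets_into_space[OF C] by auto
      ultimately show "x \<in> (\<Pi>\<^sub>E i\<in>{..<n}. {0})"
        by (auto simp: space_PiM PiE_iff extensional_def fun_eq_iff)
    qed
    then have "emeasure ?L {x \<in> C. norm_on n x \<le> 0} \<le> emeasure ?L (\<Pi>\<^sub>E i\<in>{..<n}. {0})"
      by (intro emeasure_mono sets_PiM_I_finite) auto
    also have "\<dots> = (\<Prod>i<n. emeasure lborel {0 :: real})"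
      by (intro L.emeasure_PiM) auto
    also have "\<dots> = 0" using n by simp
    finally show ?thesis using True n by simp
  next
    case False
    with r have r: "0 < r" by simp
    have "emeasure ?L {x \<in> C. norm_on n x \<le> r} = (\<integral>\<^sup>+x. indicator {x \<in> C. norm_on n x \<le> r} x \<partial>?L)"
      by simp
    also have "\<dots> = ennreal (r ^ n) * (\<integral>\<^sup>+x. indicator {x \<in> C. norm_on n x \<le> r} (scale_on n r x) \<partial>?L)"
      by (rule nn_integral_PiM_lborel_scale[OF r]) simp
    also have "(\<lambda>x. indicator {x \<in> C. norm_on n x \<le> r} (scale_on n r x) :: ennreal)
        = indicator {x \<in> C. norm_on n x \<le> 1}"
      using r cone[OF r] by (auto simp: indicator_def norm_on_scale fun_eq_iff)
    finally show ?thesis by simp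
  qed
qed

text \<open>
  Layer-cake decomposition: a standard Gaussian vector is a mixture of uniform distributions on
  centred balls, because \<open>exp (- a\<^sup>2 / 2)\<close> is the integral of \<open>\<rho> exp (- \<rho>\<^sup>2 / 2)\<close> over \<open>\<rho> \<ge> a\<close>.
\<close>

definition radial_weight :: "nat \<Rightarrow> real \<Rightarrow> ennreal" where
  "radial_weight n \<rho> = ennreal ((1 / sqrt (2 * pi)) ^ n * (\<rho> * exp (- \<rho>\<^sup>2 / 2))) * indicator {0..} \<rho>"

lemma measurable_radial_weight [measurable]: "radial_weight n \<in> borel_measurable borel"
  unfolding radial_weight_def by measurable

lemma emeasure_std_gaussian_radial:
  assumes A[measurable]: "A \<in> sets (\<Pi>\<^sub>M i\<in>{..<n}. lborel)"
  shows "emeasure (std_gaussian n) A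
    = (\<integral>\<^sup>+\<rho>. radial_weight n \<rho> * emeasure (\<Pi>\<^sub>M i\<in>{..<n}. lborel) {x \<in> A. norm_on n x \<le> \<rho>} \<partial>lborel)"
proof -
  let ?L = "\<Pi>\<^sub>M i\<in>{..<n}. lborel :: real measure"
  interpret L: product_sigma_finite "\<lambda>_ :: nat. lborel :: real measure" ..
  interpret pair_sigma_finite "lborel :: real measure" ?L
    by (intro pair_sigma_finite.intro L.sigma_finite sigma_finite_lborel) simp
  define k where "k = (1 / sqrt (2 * pi)) ^ n"
  have k: "0 \<le> k" by (simp add: k_def)
  have gauss: "ennreal (k * exp (- inner_on n x x / 2))
      = (\<integral>\<^sup>+\<rho>. radial_weight n \<rho> * (if norm_on n x \<le> \<rho> then 1 else 0) \<partial>lborel)" for x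
  proof -
    let ?a = "norm_on n x"
    have "(\<integral>\<^sup>+\<rho>. ennreal (k * (\<rho> * exp (- \<rho>\<^sup>2 / 2))) * indicator {?a..} \<rho> \<partial>lborel)
        = 0 - (- (k * exp (- ?a\<^sup>2 / 2)))"
    proof (rule nn_integral_FTC_atLeast)
      fix \<rho> assume \<rho>: "?a \<le> \<rho>"
      show "((\<lambda>\<rho>. - (k * exp (- \<rho>\<^sup>2 / 2))) has_real_derivative k * (\<rho> * exp (- \<rho>\<^sup>2 / 2))) (at \<rho>)"
        by (auto intro!: derivative_eq_intros)
      show "0 \<le> k * (\<rho> * exp (- \<rho>\<^sup>2 / 2))"
        using k order_trans[OF norm_on_nonneg \<rho>] by (intro mult_nonneg_nonneg) auto
    next
      have "((\<lambda>\<rho>::real. exp (- \<rho>\<^sup>2 / 2)) \<longlongrightarrow> 0) at_top"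
        by real_asymp
      from tendsto_mult_left[OF this, of "- k"]
      show "((\<lambda>\<rho>. - (k * exp (- \<rho>\<^sup>2 / 2))) \<longlongrightarrow> 0) at_top" by simp
    qed measurable
    also have "(\<lambda>\<rho>. ennreal (k * (\<rho> * exp (- \<rho>\<^sup>2 / 2))) * indicator {?a..} \<rho>)
        = (\<lambda>\<rho>. radial_weight n \<rho> * (if ?a \<le> \<rho> then 1 else 0))"
    proof
      fix \<rho> :: real
      show "ennreal (k * (\<rho> * exp (- \<rho>\<^sup>2 / 2))) * indicator {?a..} \<rho>
          = radial_weight n \<rho> * (if ?a \<le> \<rho> then 1 else 0)"
        using order_trans[OF norm_on_nonneg[of n x], of \<rho>]
        by (cases "?a \<le> \<rho>") (auto simp: radial_weight_def k_def)
    qed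
    finally show ?thesis by (simp add: norm_on_power2)
  qed
  have "emeasure (std_gaussian n) A
      = (\<integral>\<^sup>+x. ennreal (k * exp (- inner_on n x x / 2)) * indicator A x \<partial>?L)"
    unfolding std_gaussian_density k_def by (rule emeasure_density) measurable
  also have "\<dots> = (\<integral>\<^sup>+x. (\<integral>\<^sup>+\<rho>. radial_weight n \<rho> * (if norm_on n x \<le> \<rho> then 1 else 0) * indicator A x \<partial>lborel) \<partial>?L)"
    unfolding gauss by (intro nn_integral_cong nn_integral_multc[symmetric]) measurable
  also have "\<dots> = (\<integral>\<^sup>+\<rho>. (\<integral>\<^sup>+x. radial_weight n \<rho> * (if norm_on n x \<le> \<rho> then 1 else 0) * indicator A x \<partial>?L) \<partial>lborel)"
    by (rule Fubini') measurable
  also have "\<dots> = (\<integral>\<^sup>+\<rho>. radial_weight n \<rho> * emeasure ?L {x \<in> A. norm_on n x \<le> \<rho>} \<partial>lborel)"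
  proof (intro nn_integral_cong)
    fix \<rho> :: real
    have "{x \<in> A. norm_on n x \<le> \<rho>} = A \<inter> {x \<in> space ?L. norm_on n x \<le> \<rho>}"
      using sets.sets_into_space[OF A] by auto
    then have [measurable]: "{x \<in> A. norm_on n x \<le> \<rho>} \<in> sets ?L" by simp
    have "(\<integral>\<^sup>+x. radial_weight n \<rho> * (if norm_on n x \<le> \<rho> then 1 else 0) * indicator A x \<partial>?L)
        = (\<integral>\<^sup>+x. radial_weight n \<rho> * indicator {x \<in> A. norm_on n x \<le> \<rho>} x \<partial>?L)"
      by (intro nn_integral_cong) (auto simp: indicator_def)
    then show "(\<integral>\<^sup>+x. radial_weight n \<rho> * (if norm_on n x \<le> \<rho> then 1 else 0) * indicator A x \<partial>?L)
        = radial_weight n \<rho> * emeasure ?L {x \<in> A. norm_on n x \<le> \<rho>}"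
      by (simp add: nn_integral_cmult)
  qed
  finally show ?thesis .
qed

lemma prob_space_std_gaussian: "prob_space (std_gaussian n)"
  unfolding std_gaussian_def
  by (intro prob_space_PiM prob_space_normal_density) auto

lemma space_std_gaussian: "space (std_gaussian n) = space (\<Pi>\<^sub>M i\<in>{..<n}. lborel :: real measure)"
  by (simp add: std_gaussian_density)

text \<open>By the layer-cake formula both Gaussian masses are \<open>b C\<close>, the volume of the
  cone inside the unit ball, times a factor \<open>\<kappa>\<close> or \<open>\<kappa>'\<close> that
  does not depend on the cone. Comparison with the whole space, a cone of Gaussian mass 1,
  eliminates these factors.\<close>

lemma
  fixes r :: real
  assumes n: "1 \<le> n" and C_sets: "C \<in> sets (\<Pi>\<^sub>M i\<in>{..<n}. lborel)"
    and C_cone: "\<And>r x. 0 < r \<Longrightarrow> scale_on n r x \<in> C \<longleftrightarrow> x \<in> C"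
  shows emeasure_cone_ball_std_gaussian:
      "emeasure (\<Pi>\<^sub>M i\<in>{..<n}. lborel) {x \<in> C. norm_on n x \<le> 1} = emeasure (std_gaussian n) C
        * emeasure (\<Pi>\<^sub>M i\<in>{..<n}. lborel) {x \<in> space (std_gaussian n). norm_on n x \<le> 1}"
    and emeasure_std_gaussian_cone_ball:
      "emeasure (std_gaussian n) {x \<in> C. norm_on n x \<le> r} = emeasure (std_gaussian n) C
        * emeasure (std_gaussian n) {x \<in> space (std_gaussian n). norm_on n x \<le> r}"
proof -
  let ?L = "\<Pi>\<^sub>M i\<in>{..<n}. lborel :: real measure"
  interpret prob_space "std_gaussian n" by (rule prob_space_std_gaussian)
  define cone where "cone C \<longleftrightarrow> C \<in> sets ?L \<and> (\<forall>r x. 0 < r \<longrightarrow> (scale_on n r x \<in> C \<longleftrightarrow> x \<in> C))" for C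
  have sp: "cone (space ?L)"
    by (auto simp: cone_def space_PiM PiE_iff extensional_def)
  define b where "b C = emeasure ?L {x \<in> C. norm_on n x \<le> 1}" for C
  have ball: "emeasure ?L {x \<in> C. norm_on n x \<le> r} = ennreal (r ^ n) * b C" if "cone C" "0 \<le> r" for C r
    unfolding b_def using that by (intro emeasure_cone_cball n) (auto simp: cone_def)
  define \<kappa> where "\<kappa> = (\<integral>\<^sup>+\<rho>. radial_weight n \<rho> * ennreal (\<rho> ^ n) \<partial>lborel)"
  have whole: "emeasure (std_gaussian n) C = \<kappa> * b C" if C: "cone C" for C
  proof -
    have "emeasure (std_gaussian n) C = (\<integral>\<^sup>+\<rho>. radial_weight n \<rho> * ennreal (\<rho> ^ n) * b C \<partial>lborel)"
      using C ball[OF C] by (subst emeasure_std_gaussian_radial)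
        (auto simp: cone_def radial_weight_def indicator_def mult.assoc intro!: nn_integral_cong)
    then show ?thesis by (simp add: \<kappa>_def nn_integral_multc)
  qed
  \<comment> \<open>The ball of radius \<open>r\<close> meets the layer of radius
    \<open>\<rho>\<close> in a ball of radius \<open>min r \<rho>\<close>.\<close>
  define \<kappa>' where "\<kappa>' r = (\<integral>\<^sup>+\<rho>. radial_weight n \<rho> * ennreal ((min r \<rho>) ^ n) \<partial>lborel)" for r
  have part: "emeasure (std_gaussian n) {x \<in> C. norm_on n x \<le> r} = \<kappa>' r * b C" if C: "cone C" and r: "0 \<le> r" for C r
  proof -
    have C': "C \<in> sets ?L" using C by (simp add: cone_def)
    have "{x \<in> C. norm_on n x \<le> r} = C \<inter> {x \<in> space ?L. norm_on n x \<le> r}"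
      using sets.sets_into_space[OF C'] by auto
    then have [measurable]: "{x \<in> C. norm_on n x \<le> r} \<in> sets ?L" using C' by simp
    have "{x \<in> {x \<in> C. norm_on n x \<le> r}. norm_on n x \<le> \<rho>} = {x \<in> C. norm_on n x \<le> min r \<rho>}" for \<rho>
      by auto
    then have "emeasure (std_gaussian n) {x \<in> C. norm_on n x \<le> r}
        = (\<integral>\<^sup>+\<rho>. radial_weight n \<rho> * emeasure ?L {x \<in> C. norm_on n x \<le> min r \<rho>} \<partial>lborel)"
      by (subst emeasure_std_gaussian_radial) simp_all
    also have "\<dots> = (\<integral>\<^sup>+\<rho>. radial_weight n \<rho> * ennreal ((min r \<rho>) ^ n) * b C \<partial>lborel)"
    proof (intro nn_integral_cong)
      fix \<rho> :: real
      show "radial_weight n \<rho> * emeasure ?L {x \<in> C. norm_on n x \<le> min r \<rho>}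
          = radial_weight n \<rho> * ennreal ((min r \<rho>) ^ n) * b C"
        using ball[OF C, of "min r \<rho>"] r
        by (cases "0 \<le> \<rho>") (simp_all add: radial_weight_def mult.assoc)
    qed
    finally show ?thesis by (simp add: \<kappa>'_def nn_integral_multc)
  qed
  have C: "cone C" using C_sets C_cone by (simp add: cone_def)
  have one: "\<kappa> * b (space ?L) = 1"
    using emeasure_space_1 whole[OF sp] by (simp add: space_std_gaussian)
  then have "b C = (\<kappa> * b (space ?L)) * b C" by simp
  also have "\<dots> = (\<kappa> * b C) * b (space ?L)" by (simp add: mult_ac)
  finally show "emeasure ?L {x \<in> C. norm_on n x \<le> 1} = emeasure (std_gaussian n) C
      * emeasure ?L {x \<in> space (std_gaussian n). norm_on n x \<le> 1}"
    using whole[OF C] by (simp add: b_def space_std_gaussian)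
  show "emeasure (std_gaussian n) {x \<in> C. norm_on n x \<le> r} = emeasure (std_gaussian n) C
      * emeasure (std_gaussian n) {x \<in> space (std_gaussian n). norm_on n x \<le> r}"
  proof (cases "0 \<le> r")
    case True
    have "\<kappa>' r * b C = (\<kappa> * b (space ?L)) * (\<kappa>' r * b C)" by (simp add: one)
    also have "\<dots> = (\<kappa> * b C) * (\<kappa>' r * b (space ?L))" by (simp add: mult_ac)
    finally show ?thesis
      using part[OF C True] part[OF sp True] whole[OF C] by (simp add: space_std_gaussian)
  next
    case False
    then have "\<not> norm_on n x \<le> r" for x using norm_on_nonneg[of n x] by linarith
    then show ?thesis by simp
  qed
qed

text \<open>Preimages under \<open>H\<close> are cones because \<open>H\<close> is constant on open
  rays, so the previous lemma is the product formula for them and closed balls. The balls are an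
  intersection-stable generator of the events of the norm, which extends the formula to all Borel
  sets.\<close>

lemma indep_norm_direction:
  fixes H :: "(nat \<Rightarrow> real) \<Rightarrow> real"
  assumes n: "1 \<le> n" and H[measurable]: "H \<in> borel_measurable (\<Pi>\<^sub>M i\<in>{..<n}. lborel)"
    and homog: "\<And>r x. 0 < r \<Longrightarrow> H (scale_on n r x) = H x"
  shows "prob_space.indep_var (std_gaussian n) borel (norm_on n) borel H"
proof -
  let ?L = "\<Pi>\<^sub>M i\<in>{..<n}. lborel :: real measure"
  interpret prob_space "std_gaussian n" by (rule prob_space_std_gaussian)
  define S where "S = space (std_gaussian n)"
  have S: "S = space ?L" by (simp add: S_def space_std_gaussian)
  have N[measurable]: "norm_on n \<in> borel_measurable (std_gaussian n)" by measurable
  have Hm[measurable]: "H \<in> borel_measurable (std_gaussian n)" by measurable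
  let ?G = "{norm_on n -` A \<inter> S | A. A \<in> range atMost}"
  let ?K = "{H -` A \<inter> S | A. A \<in> sets borel}"
  have ind: "prob ((norm_on n -` {..a} \<inter> S) \<inter> (H -` B \<inter> S)) = prob (norm_on n -` {..a} \<inter> S) * prob (H -` B \<inter> S)"
    if B: "B \<in> sets borel" for a B
  proof -
    have "scale_on n r x \<in> S \<longleftrightarrow> x \<in> S" for r x
      by (auto simp: S space_PiM PiE_iff extensional_def)
    then have "emeasure (std_gaussian n) {x \<in> H -` B \<inter> S. norm_on n x \<le> a}
        = emeasure (std_gaussian n) (H -` B \<inter> S) * emeasure (std_gaussian n) {x \<in> S. norm_on n x \<le> a}"
      unfolding S_def using homog measurable_sets[OF H B] n
      by (intro emeasure_std_gaussian_cone_ball) (auto simp: S_def space_std_gaussian)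
    moreover have "{x \<in> H -` B \<inter> S. norm_on n x \<le> a} = (norm_on n -` {..a} \<inter> S) \<inter> (H -` B \<inter> S)"
      "{x \<in> S. norm_on n x \<le> a} = norm_on n -` {..a} \<inter> S" by auto
    ultimately have "emeasure (std_gaussian n) ((norm_on n -` {..a} \<inter> S) \<inter> (H -` B \<inter> S))
        = emeasure (std_gaussian n) (H -` B \<inter> S) * emeasure (std_gaussian n) (norm_on n -` {..a} \<inter> S)"
      by metis
    then show ?thesis
      by (simp add: emeasure_eq_measure mult.commute flip: ennreal_mult)
  qed
  have "indep_set ?G ?K"
    unfolding indep_sets2_eq
    using ind measurable_sets[OF N, folded S_def] measurable_sets[OF Hm, folded S_def] by auto
  moreover have "Int_stable ?G"
  proof (rule Int_stableI)
    fix a b assume "a \<in> ?G" "b \<in> ?G"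
    then obtain x y where "a = norm_on n -` {..x} \<inter> S" "b = norm_on n -` {..y} \<inter> S" by auto
    then have "a \<inter> b = norm_on n -` {..min x y} \<inter> S" by auto
    then show "a \<inter> b \<in> ?G" by blast
  qed
  moreover have "Int_stable ?K"
  proof (rule Int_stableI)
    fix a b assume "a \<in> ?K" "b \<in> ?K"
    then obtain A B where AB: "a = H -` A \<inter> S" "b = H -` B \<inter> S" "A \<in> sets borel" "B \<in> sets borel" by auto
    then have "a \<inter> b = H -` (A \<inter> B) \<inter> S" "A \<inter> B \<in> sets borel" by auto
    then show "a \<inter> b \<in> ?K" by blast
  qed
  ultimately have "indep_set (sigma_sets S ?G) (sigma_sets S ?K)"
    unfolding S_def by (rule indep_set_sigma_sets)
  moreover have "sigma_sets S ?G = {norm_on n -` A \<inter> S | A. A \<in> sets borel}"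
  proof -
    have "sets borel = sigma_sets UNIV (range (atMost :: real \<Rightarrow> real set))"
      by (subst borel_eq_atMost) (simp add: sets_measure_of)
    then show ?thesis
      using sigma_sets_vimage_commute[of "norm_on n" S UNIV "range atMost"] by simp
  qed
  moreover have "sigma_sets S {norm_on n -` A \<inter> S | A. A \<in> sets borel} = {norm_on n -` A \<inter> S | A. A \<in> sets borel}"
    using sigma_sets_vimage_commute[of "norm_on n" S UNIV "sets (borel :: real measure)"] sets.sigma_sets_eq[of "borel :: real measure"]
    by simp
  ultimately show ?thesis
    unfolding indep_var_eq by (simp add: S_def)
qed

subsection \<open>From zones to Gaussian tails\<close>

text \<open>The total Gaussian mass 1 is a radial integral \<open>\<kappa>\<close> times the volume
  of the ball, which rules out the volumes 0 and infinity. Both facts serve to cancel this volume in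
  \<open>uniform_measure\<close>.\<close>

lemma emeasure_unit_ball:
  assumes n: "1 \<le> n"
  shows "emeasure (\<Pi>\<^sub>M i\<in>{..<n}. lborel) (unit_ball n) \<noteq> 0"
    "emeasure (\<Pi>\<^sub>M i\<in>{..<n}. lborel) (unit_ball n) \<noteq> \<infinity>"
    "unit_ball n \<in> sets (\<Pi>\<^sub>M i\<in>{..<n}. lborel)"
proof -
  let ?L = "\<Pi>\<^sub>M i\<in>{..<n}. lborel :: real measure"
  interpret prob_space "std_gaussian n" by (rule prob_space_std_gaussian)
  have ball: "unit_ball n = {x \<in> space ?L. norm_on n x \<le> 1}"
    by (auto simp: unit_ball_def space_PiM)
  show "unit_ball n \<in> sets ?L" unfolding ball by measurable
  have cone: "scale_on n r x \<in> space ?L \<longleftrightarrow> x \<in> space ?L" for r x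
    by (auto simp: space_PiM PiE_iff extensional_def)
  define \<kappa> where "\<kappa> = (\<integral>\<^sup>+\<rho>. radial_weight n \<rho> * ennreal (\<rho> ^ n) \<partial>lborel)"
  have "1 = emeasure (std_gaussian n) (space ?L)"
    using emeasure_space_1 by (simp add: space_std_gaussian)
  also have "\<dots> = (\<integral>\<^sup>+\<rho>. radial_weight n \<rho> * ennreal (\<rho> ^ n) * emeasure ?L (unit_ball n) \<partial>lborel)"
    unfolding emeasure_std_gaussian_radial[OF sets.top]
  proof (intro nn_integral_cong)
    fix \<rho> :: real
    show "radial_weight n \<rho> * emeasure ?L {x \<in> space ?L. norm_on n x \<le> \<rho>}
        = radial_weight n \<rho> * ennreal (\<rho> ^ n) * emeasure ?L (unit_ball n)"
      using emeasure_cone_cball[OF n, of \<rho> "space ?L"] cone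
      by (cases "0 \<le> \<rho>") (simp_all add: ball radial_weight_def mult.assoc)
  qed
  also have "\<dots> = \<kappa> * emeasure ?L (unit_ball n)"
    by (simp add: \<kappa>_def nn_integral_multc)
  finally have "\<kappa> * emeasure ?L (unit_ball n) = 1" by simp
  then show "emeasure ?L (unit_ball n) \<noteq> 0" "emeasure ?L (unit_ball n) \<noteq> \<infinity>"
    by (auto simp: ennreal_mult_top split: if_splits)
qed

section \<open>Minima of inner products, and zones as sections of cones\<close>

lemma inner_on_commute: "inner_on n x y = inner_on n y x"
  by (simp add: inner_on_def mult.commute)

lemma inner_on_Cauchy_Schwarz: "\<bar>inner_on n x y\<bar> \<le> norm_on n x * norm_on n y"
proof -
  have "(inner_on n x y)\<^sup>2 \<le> inner_on n x x * inner_on n y y"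
    using Cauchy_Schwarz_ineq_sum[of x y "{..<n}"] by (simp add: inner_on_def power2_eq_square)
  then show ?thesis
    unfolding norm_on_def by (metis real_sqrt_abs real_sqrt_le_iff real_sqrt_mult)
qed

definition min_inner :: "nat \<Rightarrow> nat \<Rightarrow> (nat \<Rightarrow> nat \<Rightarrow> real) \<Rightarrow> (nat \<Rightarrow> real) \<Rightarrow> real" where
  "min_inner d m u z = (MIN j\<in>{..<m}. \<bar>inner_on d (u j) z\<bar>)"

lemma measurable_min_inner [measurable]:
  assumes [measurable]: "\<And>i. i < d \<Longrightarrow> (\<lambda>z. f z i) \<in> borel_measurable M"
  shows "(\<lambda>z. min_inner d m u (f z)) \<in> borel_measurable M"
  unfolding min_inner_def by (intro borel_measurable_Min) auto

lemma sets_min_inner_cone: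
  "{x \<in> space (\<Pi>\<^sub>M i\<in>{..<d}. lborel). 0 < norm_on d x \<and> min_inner d m u x \<le> s * norm_on d x}
    \<in> sets (\<Pi>\<^sub>M i\<in>{..<d}. lborel)"
  by (intro sets.sets_Collect_conj borel_measurable_le borel_measurable_less borel_measurable_times) measurable

lemma min_inner_le_iff:
  assumes "1 \<le> m"
  shows "min_inner d m u z \<le> t \<longleftrightarrow> (\<exists>j<m. \<bar>inner_on d (u j) z\<bar> \<le> t)"
  using assms unfolding min_inner_def by (subst Min_le_iff) (auto simp: lessThan_empty_iff)

lemma min_inner_nonneg:
  assumes "1 \<le> m"
  shows "0 \<le> min_inner d m u z"
  using assms unfolding min_inner_def by (subst Min_ge_iff) (auto simp: lessThan_empty_iff)

lemma min_inner_scale: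
  assumes m: "1 \<le> m" and r: "0 < r"
  shows "min_inner d m u (scale_on d r z) = r * min_inner d m u z"
proof -
  have inner: "inner_on d (u j) (scale_on d r z) = r * inner_on d (u j) z" for j
    by (simp add: inner_on_def sum_distrib_left mult_ac)
  have "r * min_inner d m u z = (MIN j\<in>{..<m}. r * \<bar>inner_on d (u j) z\<bar>)"
    using mono_Min_commute[of "\<lambda>x. r * x" "(\<lambda>j. \<bar>inner_on d (u j) z\<bar>) ` {..<m}"] m r
    by (auto simp: min_inner_def image_image mono_def lessThan_empty_iff)
  then show ?thesis using r by (simp add: min_inner_def inner abs_mult)
qed

lemma min_inner_le_norm:
  assumes "1 \<le> m" "\<And>j. j < m \<Longrightarrow> norm_on d (u j) = 1"
  shows "min_inner d m u z \<le> norm_on d z"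
  unfolding min_inner_le_iff[OF assms(1)]
  using assms inner_on_Cauchy_Schwarz[of d "u 0" z] by (intro exI[of _ 0]) auto

text \<open>Pulled back along \<open>radial_proj\<close>, the union of zones becomes a cone without
  the origin, whose projection lies off the sphere. The share of the unit ball in this cone is its
  Gaussian mass.\<close>

lemma sphere_measure_zones:
  assumes d: "1 \<le> d" and m: "1 \<le> m"
  shows "measure (sphere_measure d) (\<Union>j<m. zone d (u j) \<alpha>)
    = measure (std_gaussian d)
        {x \<in> space (std_gaussian d). 0 < norm_on d x \<and> min_inner d m u x \<le> sin \<alpha> * norm_on d x}"
proof -
  let ?L = "\<Pi>\<^sub>M i\<in>{..<d}. lborel :: real measure"
  let ?B = "\<Pi>\<^sub>M i\<in>{..<d}. borel :: real measure"
  let ?E = "\<Union>j<m. zone d (u j) \<alpha>"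
  let ?C = "{x \<in> space ?L. 0 < norm_on d x \<and> min_inner d m u x \<le> sin \<alpha> * norm_on d x}"
  note ub = emeasure_unit_ball[OF d]
  have sphere: "unit_sphere d = {x \<in> space ?B. norm_on d x = 1}"
    by (auto simp: unit_sphere_def space_PiM)
  have sphere_sets[measurable]: "unit_sphere d \<in> sets ?B" unfolding sphere by measurable
  have "zone d (u j) \<alpha> = {x \<in> space ?B. norm_on d x = 1 \<and> \<bar>inner_on d x (u j)\<bar> \<le> sin \<alpha>}" for j
    by (auto simp: zone_def unit_sphere_def space_PiM)
  then have [measurable]: "zone d (u j) \<alpha> \<in> sets ?B" for j by simp
  have E[measurable]: "?E \<in> sets ?B" by measurable
  have proj[measurable]: "radial_proj d \<in> uniform_measure ?L (unit_ball d) \<rightarrow>\<^sub>M ?B"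
    unfolding radial_proj_def by measurable
  have pre: "radial_proj d -` ?E \<inter> space ?L = ?C"
  proof -
    have inner: "inner_on d (radial_proj d x) y = inner_on d x y / norm_on d x" for x y
      by (simp add: inner_on_def radial_proj_def sum_divide_distrib)
    have norm: "norm_on d (radial_proj d x) = 1 \<longleftrightarrow> 0 < norm_on d x" for x
    proof -
      have "inner_on d (radial_proj d x) (radial_proj d x) = inner_on d x x / (norm_on d x)\<^sup>2"
        by (simp add: inner_on_def radial_proj_def sum_divide_distrib power2_eq_square)
      then have "norm_on d (radial_proj d x) = norm_on d x / norm_on d x"
        by (simp add: norm_on_def[of d "radial_proj d x"] real_sqrt_divide norm_on_def[of d x, symmetric])
      then show ?thesis using norm_on_nonneg[of d x] by (cases "norm_on d x = 0") (auto simp: less_le)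
    qed
    have ext: "radial_proj d x \<in> {..<d} \<rightarrow>\<^sub>E UNIV" for x by (auto simp: radial_proj_def)
    have "radial_proj d x \<in> zone d (u j) \<alpha> \<longleftrightarrow>
        0 < norm_on d x \<and> \<bar>inner_on d (u j) x\<bar> \<le> sin \<alpha> * norm_on d x" for x j
    proof (cases "0 < norm_on d x")
      case True
      then have "\<bar>inner_on d (radial_proj d x) (u j)\<bar> = \<bar>inner_on d (u j) x\<bar> / norm_on d x"
        unfolding inner inner_on_commute[of d x] by simp
      with True ext show ?thesis by (simp add: zone_def unit_sphere_def norm pos_divide_le_eq)
    qed (simp add: zone_def unit_sphere_def norm)
    then show ?thesis by (auto simp: min_inner_le_iff[OF m])
  qed
  note C = sets_min_inner_cone[of d m u "sin \<alpha>"]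
  have cone: "scale_on d r x \<in> ?C \<longleftrightarrow> x \<in> ?C" if "0 < r" for r x
    using that by (auto simp: space_PiM PiE_iff extensional_def min_inner_scale[OF m] norm_on_scale zero_less_mult_iff)
  have int: "unit_ball d \<inter> ?C = {x \<in> ?C. norm_on d x \<le> 1}"
    by (auto simp: unit_ball_def space_PiM)
  have ball: "{x \<in> space (std_gaussian d). norm_on d x \<le> 1} = unit_ball d"
    by (auto simp: unit_ball_def space_std_gaussian space_PiM)
  have eqn: "emeasure ?L {x \<in> ?C. norm_on d x \<le> 1} = emeasure (std_gaussian d) ?C * emeasure ?L (unit_ball d)"
    unfolding ball[symmetric] by (rule emeasure_cone_ball_std_gaussian[OF d C]) (rule cone)
  have "emeasure (sphere_measure d) ?E = emeasure (distr (uniform_measure ?L (unit_ball d)) ?B (radial_proj d)) ?E"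
    unfolding sphere_measure_def
    by (rule emeasure_restrict_space) (auto simp: zone_def intro!: sets.Int)
  also have "\<dots> = emeasure (uniform_measure ?L (unit_ball d)) ?C"
    by (subst emeasure_distr[OF proj E]) (simp add: pre)
  also have "\<dots> = emeasure ?L {x \<in> ?C. norm_on d x \<le> 1} / emeasure ?L (unit_ball d)"
    using ub C by (subst emeasure_uniform_measure) (auto simp: int)
  also have "\<dots> = emeasure (std_gaussian d) ?C * emeasure ?L (unit_ball d) / emeasure ?L (unit_ball d)"
    by (simp only: eqn)
  also have "\<dots> = emeasure (std_gaussian d) ?C"
    using ub by (simp add: ennreal_mult_divide_eq)
  finally show ?thesis by (simp add: measure_def space_std_gaussian)
qed

text \<open>Independence makes the joint law a product measure, and Fubini fixes the value
  \<open>r\<close> of \<open>R\<close>. Two choices of \<open>H\<close> can then be compared for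
  each \<open>r\<close> separately.\<close>

lemma (in prob_space) emeasure_indep_product_greater:
  fixes R H :: "'a \<Rightarrow> real"
  assumes ind: "indep_var borel R borel H"
  shows "emeasure M {x \<in> space M. 0 < R x \<and> t < R x * H x}
    = (\<integral>\<^sup>+r. emeasure M {x \<in> space M. 0 < r \<and> t < r * H x} \<partial>distr M borel R)"
proof -
  have R[measurable]: "R \<in> borel_measurable M" and H[measurable]: "H \<in> borel_measurable M"
    and eq: "distr M borel R \<Otimes>\<^sub>M distr M borel H = distr M (borel \<Otimes>\<^sub>M borel) (\<lambda>x. (R x, H x))"
    using ind unfolding indep_var_distribution_eq by auto
  interpret H: prob_space "distr M borel H" by (rule prob_space_distr) measurable
  define X where "X = {p \<in> space (borel \<Otimes>\<^sub>M borel). 0 < fst p \<and> t < fst p * (snd p :: real)}"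
  have X[measurable]: "X \<in> sets (borel \<Otimes>\<^sub>M borel)" unfolding X_def by measurable
  have "{x \<in> space M. 0 < R x \<and> t < R x * H x} = (\<lambda>x. (R x, H x)) -` X \<inter> space M"
    by (auto simp: X_def space_pair_measure)
  then have "emeasure M {x \<in> space M. 0 < R x \<and> t < R x * H x}
      = emeasure (distr M borel R \<Otimes>\<^sub>M distr M borel H) X"
    unfolding eq by (subst emeasure_distr) auto
  also have "\<dots> = (\<integral>\<^sup>+r. emeasure (distr M borel H) (Pair r -` X) \<partial>distr M borel R)"
    by (rule H.emeasure_pair_measure_alt) simp
  also have "\<dots> = (\<integral>\<^sup>+r. emeasure M {x \<in> space M. 0 < r \<and> t < r * H x} \<partial>distr M borel R)"
  proof (intro nn_integral_cong)
    fix r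
    have "Pair r -` X = {h. 0 < r \<and> t < r * h}" by (auto simp: X_def space_pair_measure)
    then show "emeasure (distr M borel H) (Pair r -` X) = emeasure M {x \<in> space M. 0 < r \<and> t < r * H x}"
      by (subst emeasure_distr) (auto intro!: arg_cong[of _ _ "emeasure M"])
  qed
  finally show ?thesis .
qed

lemma inner_on_planar_vec:
  assumes "2 \<le> d"
  shows "inner_on d (planar_vec d n j) z = cos (real j * pi / real n) * z 0 + sin (real j * pi / real n) * z 1"
proof -
  have "inner_on d (planar_vec d n j) z = (\<Sum>k\<in>{0, 1}. planar_vec d n j k * z k)"
    unfolding inner_on_def using assms
    by (intro sum.mono_neutral_right) (auto simp: planar_vec_def)
  then show ?thesis using assms by (simp add: planar_vec_def)
qed

lemma norm_on_planar_vec: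
  assumes "2 \<le> d"
  shows "norm_on d (planar_vec d n j) = 1"
  using assms unfolding norm_on_def inner_on_planar_vec[OF assms]
  by (simp add: planar_vec_def flip: power2_eq_square)

text \<open>For \<open>s \<le> 1\<close> this is the conjecture at the angle
  \<open>arcsin s\<close>. For larger \<open>s\<close> there is no such angle, but the right-hand
  event is the whole space since the ratio is at most 1 by Cauchy-Schwarz.\<close>

lemma zone_conjecture_min_inner_ratio:
  assumes conj: volumetric_zone_conjecture and d: "2 \<le> d" and m: "1 \<le> m"
    and u: "\<And>j. j < m \<Longrightarrow> u j \<in> unit_sphere d" and s: "0 \<le> s"
  shows "measure (std_gaussian d) {x \<in> space (std_gaussian d). min_inner d m u x / norm_on d x \<le> s}
    \<le> measure (std_gaussian d) {x \<in> space (std_gaussian d). min_inner d m (planar_vec d m) x / norm_on d x \<le> s}"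
    (is "?P u \<le> ?P ?v")
proof -
  interpret prob_space "std_gaussian d" by (rule prob_space_std_gaussian)
  have d1: "1 \<le> d" using d by simp
  show ?thesis
  proof (cases "s \<le> 1")
    case True
    define \<alpha> where "\<alpha> = arcsin s"
    have sin: "sin \<alpha> = s" using s True by (simp add: \<alpha>_def)
    have \<alpha>: "\<alpha> \<in> {0..pi/2}"
      using s True arcsin_le_arcsin[of 0 s] arcsin_ubound[of s] by (auto simp: \<alpha>_def)
    let ?Z = "\<lambda>u. {x \<in> space (std_gaussian d). 0 < norm_on d x \<and> min_inner d m u x \<le> s * norm_on d x}"
    \<comment> \<open>Division by zero gives the ratio the value 0 at the origin, so both events
      contain \<open>?O\<close> in addition to the cones of the conjecture; its mass appears on both
      sides.\<close>
    let ?O = "{x \<in> space (std_gaussian d). norm_on d x = 0}"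
    have split: "?P u = prob (?Z u) + prob ?O" for u
    proof -
      have "min_inner d m u x / norm_on d x \<le> s \<longleftrightarrow>
          0 < norm_on d x \<and> min_inner d m u x \<le> s * norm_on d x \<or> norm_on d x = 0" for x
        using s norm_on_nonneg[of d x]
        by (cases "norm_on d x = 0") (auto simp: pos_divide_le_eq less_le)
      then have "{x \<in> space (std_gaussian d). min_inner d m u x / norm_on d x \<le> s} = ?Z u \<union> ?O"
        by auto
      moreover have "prob (?Z u \<union> ?O) = prob (?Z u) + prob ?O"
      proof (rule finite_measure_Union)
        show "?Z u \<in> events" unfolding space_std_gaussian sets_std_gaussian by (rule sets_min_inner_cone)
        show "?O \<in> events" by measurable
      qed auto
      ultimately show ?thesis by simp
    qed
    have "measure (sphere_measure d) (\<Union>j<m. zone d (u j) \<alpha>)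
        \<le> measure (sphere_measure d) (\<Union>j<m. zone d (planar_vec d m j) \<alpha>)"
      by (rule conj[unfolded volumetric_zone_conjecture_def, THEN spec, THEN mp, OF d, THEN spec, THEN mp,
            OF m, THEN spec, of u, THEN bspec, OF \<alpha>, THEN mp]) (use u in blast)
    then have "prob (?Z u) \<le> prob (?Z ?v)"
      by (simp add: sphere_measure_zones[OF d1 m] sin)
    then show ?thesis unfolding split by simp
  next
    case False
    have "min_inner d m ?v x / norm_on d x \<le> s" for x
    proof -
      have "min_inner d m ?v x / norm_on d x \<le> 1"
        using min_inner_le_norm[OF m norm_on_planar_vec[OF d], where z = x] norm_on_nonneg[of d x]
        by (cases "norm_on d x = 0") (simp_all add: less_le)
      then show ?thesis using False by simp
    qed
    then show ?thesis by (simp add: prob_space)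
  qed
qed

text \<open>Complements turn the comparison of ratios into one of strict tails. Given that the norm
  is \<open>r > 0\<close>, the minimum exceeds \<open>t\<close> exactly if the ratio exceeds
  \<open>t / r\<close>.\<close>

lemma zone_conjecture_min_inner_greater:
  assumes conj: volumetric_zone_conjecture and d: "2 \<le> d" and m: "1 \<le> m"
    and u: "\<And>j. j < m \<Longrightarrow> u j \<in> unit_sphere d" and t: "0 \<le> t"
  shows "measure (std_gaussian d) {x \<in> space (std_gaussian d). t < min_inner d m (planar_vec d m) x}
    \<le> measure (std_gaussian d) {x \<in> space (std_gaussian d). t < min_inner d m u x}"
proof -
  interpret prob_space "std_gaussian d" by (rule prob_space_std_gaussian)
  let ?v = "planar_vec d m"
  have d1: "1 \<le> d" using d by simp
  define H where "H u x = min_inner d m u x / norm_on d x" for u x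
  have Hm[measurable]: "H u \<in> borel_measurable (\<Pi>\<^sub>M i\<in>{..<d}. lborel)" for u
    unfolding H_def by measurable
  have homog: "H u (scale_on d r x) = H u x" if "0 < r" for u r x
    using that by (simp add: H_def min_inner_scale[OF m] norm_on_scale)
  have ind: "indep_var borel (norm_on d) borel (H w)" for w
    by (rule indep_norm_direction[OF d1 Hm]) (rule homog)
  have tail: "prob {x \<in> space (std_gaussian d). s < H ?v x} \<le> prob {x \<in> space (std_gaussian d). s < H u x}"
    if s: "0 \<le> s" for s
  proof -
    have compl: "prob {x \<in> space (std_gaussian d). s < H w x}
        = 1 - prob {x \<in> space (std_gaussian d). H w x \<le> s}" for w
    proof -
      have "{x \<in> space (std_gaussian d). s < H w x}
          = space (std_gaussian d) - {x \<in> space (std_gaussian d). H w x \<le> s}" by auto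
      then show ?thesis by (simp add: prob_compl)
    qed
    show ?thesis
      using zone_conjecture_min_inner_ratio[OF conj d m u s] unfolding compl by (simp add: H_def)
  qed
  \<comment> \<open>At the origin both sides fail: the minimum is at most 0 there and
    \<open>t\<close> is nonnegative.\<close>
  have eq: "{x \<in> space (std_gaussian d). t < min_inner d m w x}
      = {x \<in> space (std_gaussian d). 0 < norm_on d x \<and> t < norm_on d x * H w x}" for w
  proof -
    have "t < min_inner d m w x \<longleftrightarrow> 0 < norm_on d x \<and> t < norm_on d x * H w x" for x
    proof (cases "norm_on d x = 0")
      case True
      have "min_inner d m w x \<le> 0"
        unfolding min_inner_le_iff[OF m] using m True inner_on_Cauchy_Schwarz[of d "w 0" x]
        by (intro exI[of _ 0]) auto
      then show ?thesis using True t by simp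
    next
      case False
      then show ?thesis using norm_on_nonneg[of d x] by (simp add: H_def less_le)
    qed
    then show ?thesis by auto
  qed
  have "emeasure (std_gaussian d) {x \<in> space (std_gaussian d). 0 < norm_on d x \<and> t < norm_on d x * H ?v x}
      \<le> emeasure (std_gaussian d) {x \<in> space (std_gaussian d). 0 < norm_on d x \<and> t < norm_on d x * H u x}"
    unfolding emeasure_indep_product_greater[OF ind[of ?v]] emeasure_indep_product_greater[OF ind[of u]]
  proof (intro nn_integral_mono)
    fix r :: real
    show "emeasure (std_gaussian d) {x \<in> space (std_gaussian d). 0 < r \<and> t < r * H ?v x}
        \<le> emeasure (std_gaussian d) {x \<in> space (std_gaussian d). 0 < r \<and> t < r * H u x}"
    proof (cases "0 < r")
      case True
      then have "0 < r \<and> t < r * h \<longleftrightarrow> t / r < h" for h by (simp add: field_simps)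
      then show ?thesis using tail[of "t / r"] t True by (simp add: emeasure_eq_measure)
    qed simp
  qed
  then show ?thesis unfolding eq by (simp add: emeasure_eq_measure)
qed

section \<open>Non-strict tails and moments\<close>

text \<open>For \<open>t > 0\<close> the non-strict event is the decreasing intersection of strict
  events at levels rising to \<open>t\<close>. At \<open>t = 0\<close> there are no nonnegative
  levels below, but then the event of \<open>Y\<close> is the whole space.\<close>

lemma (in prob_space) tail_ge_le_of_tail_greater_le:
  fixes X Y :: "'a \<Rightarrow> real"
  assumes [measurable]: "X \<in> borel_measurable M" "Y \<in> borel_measurable M"
    and greater: "\<And>t. 0 \<le> t \<Longrightarrow> prob {x \<in> space M. t < X x} \<le> prob {x \<in> space M. t < Y x}"
    and Y: "\<And>x. x \<in> space M \<Longrightarrow> 0 \<le> Y x" and t: "0 \<le> t"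
  shows "prob {x \<in> space M. t \<le> X x} \<le> prob {x \<in> space M. t \<le> Y x}"
proof (cases "t = 0")
  case True
  then have "{x \<in> space M. t \<le> Y x} = space M" using Y by auto
  then show ?thesis by (simp add: prob_space)
next
  case False
  with t have t: "0 < t" by simp
  \<comment> \<open>The levels start at 0 and approach \<open>t\<close> strictly from below, so
    \<open>greater\<close> applies to each of them.\<close>
  define a where "a k = t - t / real (Suc k)" for k
  have a0: "0 \<le> a k" for k using t by (simp add: a_def field_simps)
  have lim: "(\<lambda>k. prob {x \<in> space M. a k < Z x}) \<longlonglongrightarrow> prob {x \<in> space M. t \<le> Z x}"
    if [measurable]: "Z \<in> borel_measurable M" for Z
  proof -
    have "t / real (Suc j) \<le> t / real (Suc i)" if "i \<le> j" for i j
      using t that by (intro divide_left_mono) auto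
    then have mono: "a i \<le> a j" if "i \<le> j" for i j using that by (auto simp: a_def)
    have "(\<lambda>k. prob {x \<in> space M. a k < Z x}) \<longlonglongrightarrow> prob (\<Inter>k. {x \<in> space M. a k < Z x})"
    proof (rule finite_Lim_measure_decseq)
      show "decseq (\<lambda>k. {x \<in> space M. a k < Z x})"
        using mono by (fastforce simp: decseq_def)
    qed auto
    moreover have "(\<Inter>k. {x \<in> space M. a k < Z x}) = {x \<in> space M. t \<le> Z x}"
    proof -
      have "(\<forall>k. a k < z) \<longleftrightarrow> t \<le> z" for z
      proof
        assume "\<forall>k. a k < z"
        moreover have "a \<longlonglongrightarrow> t"
          unfolding a_def using tendsto_diff[OF tendsto_const lim_const_over_n[of t, THEN LIMSEQ_Suc]]
          by simp
        ultimately show "t \<le> z" by (intro LIMSEQ_le_const2[of a]) (auto intro: less_imp_le)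
      next
        assume "t \<le> z"
        moreover have "a k < t" for k using t by (simp add: a_def)
        ultimately show "\<forall>k. a k < z" by (meson less_le_trans)
      qed
      then show ?thesis by auto
    qed
    ultimately show ?thesis by simp
  qed
  show ?thesis
    by (rule LIMSEQ_le[OF lim lim]) (use greater a0 in auto)
qed

text \<open>\<open>X x powr p\<close> is the length of the interval from 0 to it, and the integrals
  are swapped. The levels \<open>t powr (1 / p)\<close> leave tails of \<open>X\<close> itself, so a
  comparison of tails integrates to one of moments, infinite ones included.\<close>

lemma (in prob_space) nn_integral_powr_layer_cake:
  fixes X :: "'a \<Rightarrow> real"
  assumes X[measurable]: "X \<in> borel_measurable M" and nonneg: "\<And>x. x \<in> space M \<Longrightarrow> 0 \<le> X x" and p: "0 < p"
  shows "(\<integral>\<^sup>+x. ennreal (X x powr p) \<partial>M)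
    = (\<integral>\<^sup>+t. indicator {0..} t * emeasure M {x \<in> space M. t powr (1 / p) \<le> X x} \<partial>lborel)"
proof -
  interpret pair_sigma_finite "lborel :: real measure" M ..
  have powr: "t \<le> a powr p \<longleftrightarrow> t powr (1 / p) \<le> a" if "0 \<le> t" "0 \<le> a" for t a :: real
  proof
    assume "t \<le> a powr p"
    then have "t powr (1 / p) \<le> (a powr p) powr (1 / p)" using that p by (intro powr_mono2) auto
    then show "t powr (1 / p) \<le> a" using that p by (simp add: powr_powr)
  next
    assume "t powr (1 / p) \<le> a"
    then have "(t powr (1 / p)) powr p \<le> a powr p" using that p by (intro powr_mono2) auto
    then show "t \<le> a powr p" using that p by (simp add: powr_powr)
  qed
  have "(\<integral>\<^sup>+x. ennreal (X x powr p) \<partial>M)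
      = (\<integral>\<^sup>+x. (\<integral>\<^sup>+t. (if 0 \<le> t \<and> t powr (1 / p) \<le> X x then 1 else 0) \<partial>lborel) \<partial>M)"
  proof (intro nn_integral_cong)
    fix x assume "x \<in> space M"
    then have "(\<lambda>t. if 0 \<le> t \<and> t powr (1 / p) \<le> X x then 1 else 0) = (indicator {0..X x powr p} :: real \<Rightarrow> ennreal)"
      using powr nonneg by (auto simp: indicator_def fun_eq_iff)
    then show "ennreal (X x powr p) = (\<integral>\<^sup>+t. (if 0 \<le> t \<and> t powr (1 / p) \<le> X x then 1 else 0) \<partial>lborel)"
      by simp
  qed
  also have "\<dots> = (\<integral>\<^sup>+t. (\<integral>\<^sup>+x. (if 0 \<le> t \<and> t powr (1 / p) \<le> X x then 1 else 0) \<partial>M) \<partial>lborel)"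
    by (rule Fubini') measurable
  also have "\<dots> = (\<integral>\<^sup>+t. indicator {0..} t * emeasure M {x \<in> space M. t powr (1 / p) \<le> X x} \<partial>lborel)"
  proof (intro nn_integral_cong)
    fix t :: real
    have "(\<integral>\<^sup>+x. (if 0 \<le> t \<and> t powr (1 / p) \<le> X x then 1 else 0) \<partial>M)
        = (\<integral>\<^sup>+x. indicator {0..} t * indicator {x \<in> space M. t powr (1 / p) \<le> X x} x \<partial>M)"
      by (intro nn_integral_cong) (auto simp: indicator_def)
    then show "(\<integral>\<^sup>+x. (if 0 \<le> t \<and> t powr (1 / p) \<le> X x then 1 else 0) \<partial>M)
        = indicator {0..} t * emeasure M {x \<in> space M. t powr (1 / p) \<le> X x}"
      by (simp add: nn_integral_cmult)
  qed
  finally show ?thesis .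
qed

section \<open>The cosine matrix and the rows of square roots\<close>

text \<open>The formula for the cosine of a difference exhibits a Gram matrix of planar vectors, so
  the quadratic form is a sum of two squares.\<close>

lemma cos_mat_correlation: "correlation_mat n (cos_mat n)"
proof -
  have A: "cos_mat n \<in> carrier_mat n n" by (simp add: cos_mat_def)
  have entry: "cos_mat n $$ (i, j) = cos (pi * real i / real n) * cos (pi * real j / real n)
      + sin (pi * real i / real n) * sin (pi * real j / real n)" if "i < n" "j < n" for i j
    using that by (simp add: cos_mat_def right_diff_distrib diff_divide_distrib cos_diff)
  have "transpose_mat (cos_mat n) = cos_mat n"
    using A by (intro eq_matI) (auto simp: entry mult.commute)
  moreover have "0 \<le> x \<bullet> (cos_mat n *\<^sub>v x)" if x: "x \<in> carrier_vec n" for x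
  proof -
    have "x \<bullet> (cos_mat n *\<^sub>v x) = (\<Sum>i<n. x $ i * cos (pi * real i / real n))\<^sup>2
        + (\<Sum>i<n. x $ i * sin (pi * real i / real n))\<^sup>2"
      unfolding scalar_prod_mult_mat_vec[OF A x x] power2_eq_square sum_product sum.distrib[symmetric]
      by (intro sum.cong refl) (simp add: entry algebra_simps)
    then show ?thesis by simp
  qed
  moreover have "cos_mat n $$ (i, i) = 1" if "i < n" for i
    using that by (simp add: cos_mat_def)
  ultimately show ?thesis using A by (simp add: correlation_mat_def psd_mat_def)
qed

text \<open>The restriction makes rows extensional, as membership in \<open>unit_sphere n\<close>
  demands.\<close>

definition sqrt_row :: "nat \<Rightarrow> real mat \<Rightarrow> nat \<Rightarrow> nat \<Rightarrow> real" where
  "sqrt_row n A j = (\<lambda>k\<in>{..<n}. psd_sqrt n A $$ (j, k))"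

lemma sqrt_row_Gram:
  assumes "psd_mat n A" "i < n" "j < n"
  shows "inner_on n (sqrt_row n A i) (sqrt_row n A j) = A $$ (i, j)"
proof -
  define B where "B = psd_sqrt n A"
  have B: "B \<in> carrier_mat n n" "transpose_mat B = B" "B * B = A"
    using psd_sqrt_correct[OF assms(1)] by (auto simp: B_def psd_mat_def)
  have sym: "B $$ (k, j) = B $$ (j, k)" if "k < n" for k
    using arg_cong[OF B(2), of "\<lambda>M. M $$ (j, k)"] that assms B(1) by simp
  have "A $$ (i, j) = (\<Sum>k<n. B $$ (i, k) * B $$ (k, j))"
    using assms B(1) by (simp flip: B(3) add: scalar_prod_def atLeast0LessThan)
  also have "\<dots> = (\<Sum>k<n. B $$ (i, k) * B $$ (j, k))"
    by (intro sum.cong) (auto simp: sym)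
  finally show ?thesis by (simp add: inner_on_def sqrt_row_def B_def)
qed

lemma min_abs_eq_min_inner:
  assumes "psd_mat n A"
  shows "min_abs n A = min_inner n n (sqrt_row n A)"
proof
  fix z
  have B: "psd_sqrt n A \<in> carrier_mat n n"
    using psd_sqrt_correct[OF assms] by (auto simp: psd_mat_def)
  have "(psd_sqrt n A *\<^sub>v vec n z) $ i = inner_on n (sqrt_row n A i) z" if "i < n" for i
    using that B by (auto simp: scalar_prod_def inner_on_def sqrt_row_def atLeast0LessThan intro!: sum.cong)
  then show "min_abs n A z = min_inner n n (sqrt_row n A) z"
    unfolding min_abs_def min_inner_def by (intro arg_cong[of _ _ Min] image_cong) auto
qed

lemma inner_on_linear:
  "inner_on n (\<lambda>k. a * x k + b * y k) z = a * inner_on n x z + b * inner_on n y z"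
  "inner_on n z (\<lambda>k. a * x k + b * y k) = a * inner_on n z x + b * inner_on n z y"
  by (simp_all add: inner_on_def algebra_simps sum.distrib sum_distrib_left)

text \<open>The Gram matrix forces the rows of the root into a plane with an orthonormal basis
  \<open>e\<close>, \<open>f\<close>, in which row \<open>j\<close> has the coordinates of
  \<open>planar_vec n n j\<close>. The inner products of a Gaussian vector with \<open>e\<close> and
  \<open>f\<close> are jointly distributed like its first two entries.\<close>

lemma measure_min_inner_cos_mat:
  assumes n: "2 \<le> n" and t: "0 \<le> t"
  shows "measure (std_gaussian n) {z \<in> space (std_gaussian n). t \<le> min_inner n n (sqrt_row n (cos_mat n)) z}
    = measure (std_gaussian n) {z \<in> space (std_gaussian n). t \<le> min_inner n n (planar_vec n n) z}"
proof -
  let ?x = "\<lambda>j. real j * pi / real n"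
  define u where "u = sqrt_row n (cos_mat n)"
  have psd: "psd_mat n (cos_mat n)" using cos_mat_correlation by (simp add: correlation_mat_def)
  have gram: "inner_on n (u i) (u j) = cos (?x i - ?x j)" if "i < n" "j < n" for i j
    using sqrt_row_Gram[OF psd that] that
    by (simp add: u_def cos_mat_def right_diff_distrib diff_divide_distrib mult.commute)
  define s where "s = sin (pi / n)"
  define c where "c = cos (pi / n)"
  have "pi / n < pi" using n pi_gt_zero by (simp add: divide_less_eq)
  then have s: "s > 0" unfolding s_def using n by (intro sin_gt_zero) auto
  have cs: "c * c = 1 - s * s"
    using sin_cos_squared_add3[of "pi / real n"] unfolding s_def c_def by linarith
  define e where "e = u 0"
  define h where "h = u 1"
  \<comment> \<open>Gram-Schmidt: row 1 has component \<open>c\<close> along row 0, and the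
    remainder has length \<open>s\<close>, which is positive because
    \<open>n \<ge> 2\<close>.\<close>
  define f where "f = (\<lambda>k. (1 / s) * h k + (- c / s) * e k)"
  have n01: "0 < n" "1 < n" using n by auto
  have ee: "inner_on n e e = 1" using gram[of 0 0] n01 by (simp add: e_def)
  have u10: "inner_on n h e = c" "inner_on n h h = 1"
    using gram[of 1 0] gram[of 1 1] n01 by (simp_all add: c_def e_def h_def)
  have f_right: "inner_on n z f = (inner_on n z h - c * inner_on n z e) / s" for z
    unfolding f_def inner_on_linear by (simp add: diff_divide_distrib)
  have f_left: "inner_on n f z = (inner_on n h z - c * inner_on n e z) / s" for z
    by (simp add: inner_on_commute[of n _ z] f_right)
  have fe: "inner_on n f e = 0" by (simp add: f_left u10 ee)
  then have ef: "inner_on n e f = 0" by (simp add: inner_on_commute)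
  have "inner_on n f f = (1 - c * c) / s / s"
    by (simp add: f_left f_right u10 ee inner_on_commute[of n e h])
  then have ff: "inner_on n f f = 1" using s cs by simp
  have comb: "inner_on n (u j) z = cos (?x j) * inner_on n e z + sin (?x j) * inner_on n f z" if j: "j < n" for j z
  proof -
    have je: "inner_on n (u j) e = cos (?x j)" using gram[OF j n01(1)] by (simp add: e_def)
    have "inner_on n (u j) h = cos (?x j) * c + sin (?x j) * s"
      using gram[OF j n01(2)] by (simp add: cos_diff c_def s_def h_def)
    then have jf: "inner_on n (u j) f = sin (?x j)"
      using s je by (simp add: f_right)
    define g where "g = (\<lambda>k. cos (?x j) * e k + sin (?x j) * f k)"
    \<comment> \<open>Row \<open>j\<close> minus the claimed combination; the Gram entries alone
      show that its norm is 0.\<close>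
    define w where "w = (\<lambda>k. 1 * u j k + (- 1) * g k)"
    have "inner_on n w w = 1 - cos (?x j) * cos (?x j) - sin (?x j) * sin (?x j)"
      using gram[OF j j] unfolding w_def g_def inner_on_linear
      by (simp add: je jf inner_on_commute[of n e "u j"] inner_on_commute[of n f "u j"] ee ff ef fe
          algebra_simps)
    then have "(\<Sum>k<n. w k * w k) = 0"
      using sin_cos_squared_add3[of "?x j"] unfolding inner_on_def by linarith
    then have "\<forall>k<n. w k * w k = 0" by (subst (asm) sum_nonneg_eq_0_iff) auto
    then have "inner_on n w z = 0" by (simp add: inner_on_def)
    then show ?thesis unfolding w_def g_def inner_on_linear by simp
  qed
  \<comment> \<open>The tail event in two coordinates: the inner products with \<open>e\<close> and
    \<open>f\<close> give the rows of the root, the entries \<open>z 0\<close> and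
    \<open>z 1\<close> give the planar vectors.\<close>
  define F :: "real \<Rightarrow> real \<Rightarrow> ennreal" where
    "F x y = (if t \<le> (MIN j\<in>{..<n}. \<bar>cos (?x j) * x + sin (?x j) * y\<bar>) then 1 else 0)" for x y
  have [measurable]: "(\<lambda>p. MIN j\<in>{..<n}. \<bar>cos (?x j) * fst p + sin (?x j) * snd p\<bar>) \<in> borel_measurable (borel \<Otimes>\<^sub>M borel)"
    by (intro borel_measurable_Min) auto
  have F: "case_prod F \<in> borel_measurable (borel \<Otimes>\<^sub>M borel)"
    unfolding F_def case_prod_beta by measurable
  have ind: "(\<integral>\<^sup>+z. (if t \<le> Y z then 1 else 0) \<partial>std_gaussian n)
      = emeasure (std_gaussian n) {z \<in> space (std_gaussian n). t \<le> Y z}"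
    if "Y \<in> borel_measurable (\<Pi>\<^sub>M i\<in>{..<n}. lborel)" for Y :: "(nat \<Rightarrow> real) \<Rightarrow> real"
  proof -
    note that[measurable]
    have "(\<integral>\<^sup>+z. (if t \<le> Y z then 1 else 0) \<partial>std_gaussian n)
        = (\<integral>\<^sup>+z. indicator {z \<in> space (std_gaussian n). t \<le> Y z} z \<partial>std_gaussian n)"
      by (intro nn_integral_cong) (auto simp: indicator_def)
    then show ?thesis by simp
  qed
  have "F (inner_on n e z) (inner_on n f z) = (if t \<le> min_inner n n u z then 1 else 0)" for z
  proof -
    have "(\<lambda>j. \<bar>cos (?x j) * inner_on n e z + sin (?x j) * inner_on n f z\<bar>) ` {..<n}
        = (\<lambda>j. \<bar>inner_on n (u j) z\<bar>) ` {..<n}"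
      using comb by (intro image_cong) auto
    then show ?thesis by (simp add: F_def min_inner_def)
  qed
  moreover have "F (z 0) (z 1) = (if t \<le> min_inner n n (planar_vec n n) z then 1 else 0)" for z
    by (simp add: F_def min_inner_def inner_on_planar_vec[OF n])
  ultimately have "emeasure (std_gaussian n) {z \<in> space (std_gaussian n). t \<le> min_inner n n u z}
      = emeasure (std_gaussian n) {z \<in> space (std_gaussian n). t \<le> min_inner n n (planar_vec n n) z}"
    using nn_integral_gaussian_orthonormal_pair[OF F n ee ff ef] by (simp add: ind)
  then show ?thesis by (simp add: measure_def u_def)
qed

lemma zone_conjecture_min_abs_tail:
  assumes conj: volumetric_zone_conjecture and n: "2 \<le> n" and A: "correlation_mat n A" and t: "0 \<le> t"
  shows "measure (std_gaussian n) {z \<in> space (std_gaussian n). min_abs n (cos_mat n) z \<ge> t}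
    \<le> measure (std_gaussian n) {z \<in> space (std_gaussian n). min_abs n A z \<ge> t}"
proof -
  interpret prob_space "std_gaussian n" by (rule prob_space_std_gaussian)
  have n1: "1 \<le> n" using n by simp
  have psd: "psd_mat n A" "psd_mat n (cos_mat n)"
    using A cos_mat_correlation by (auto simp: correlation_mat_def)
  have unit: "sqrt_row n A j \<in> unit_sphere n" if "j < n" for j
    using sqrt_row_Gram[OF psd(1) that that] A that
    by (auto simp: unit_sphere_def norm_on_def correlation_mat_def sqrt_row_def)
  have "prob {z \<in> space (std_gaussian n). t \<le> min_inner n n (planar_vec n n) z}
      \<le> prob {z \<in> space (std_gaussian n). t \<le> min_inner n n (sqrt_row n A) z}"
    using zone_conjecture_min_inner_greater[OF conj n n1 unit] min_inner_nonneg[OF n1] t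
    by (intro tail_ge_le_of_tail_greater_le) auto
  then show ?thesis
    by (simp add: min_abs_eq_min_inner psd measure_min_inner_cos_mat[OF n t])
qed

theorem theorem4p2:
  assumes "volumetric_zone_conjecture"
  shows "\<forall>n\<ge>1. \<forall>A. correlation_mat n A \<longrightarrow>
    (\<forall>t\<ge>0. measure (std_gaussian n) {z \<in> space (std_gaussian n). min_abs n (cos_mat n) z \<ge> t}
         \<le> measure (std_gaussian n) {z \<in> space (std_gaussian n). min_abs n A z \<ge> t}) \<and>
    (\<forall>p>0. (\<integral>\<^sup>+ z. ennreal (min_abs n (cos_mat n) z powr p) \<partial>std_gaussian n)
         \<le> (\<integral>\<^sup>+ z. ennreal (min_abs n A z powr p) \<partial>std_gaussian n))"
proof (intro allI impI)
  fix n :: nat and A assume n: "1 \<le> n" and A: "correlation_mat n A"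
  interpret prob_space "std_gaussian n" by (rule prob_space_std_gaussian)
  have tail: "prob {z \<in> space (std_gaussian n). min_abs n (cos_mat n) z \<ge> t}
      \<le> prob {z \<in> space (std_gaussian n). min_abs n A z \<ge> t}" if t: "0 \<le> t" for t
  proof (cases "2 \<le> n")
    case True
    then show ?thesis using zone_conjecture_min_abs_tail assms A t by blast
  next
    case False
    then have "n = 1" using n by simp
    then have "A = cos_mat n"
      using A by (intro eq_matI) (auto simp: correlation_mat_def psd_mat_def cos_mat_def)
    then show ?thesis by simp
  qed
  have psd: "psd_mat n A" "psd_mat n (cos_mat n)"
    using A cos_mat_correlation by (auto simp: correlation_mat_def)
  have meas: "min_abs n B \<in> borel_measurable (std_gaussian n)" and nonneg: "0 \<le> min_abs n B z"
    if "psd_mat n B" for B z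
    unfolding min_abs_eq_min_inner[OF that] using min_inner_nonneg[OF n] by auto
  have "(\<integral>\<^sup>+z. ennreal (min_abs n (cos_mat n) z powr p) \<partial>std_gaussian n)
      \<le> (\<integral>\<^sup>+z. ennreal (min_abs n A z powr p) \<partial>std_gaussian n)" if p: "0 < p" for p
    unfolding nn_integral_powr_layer_cake[OF meas[OF psd(1)] nonneg[OF psd(1)] p]
      nn_integral_powr_layer_cake[OF meas[OF psd(2)] nonneg[OF psd(2)] p]
    by (intro nn_integral_mono mult_left_mono) (auto simp: emeasure_eq_measure intro: tail)
  with tail show "(\<forall>t\<ge>0. prob {z \<in> space (std_gaussian n). min_abs n (cos_mat n) z \<ge> t}
         \<le> prob {z \<in> space (std_gaussian n). min_abs n A z \<ge> t}) \<and>
    (\<forall>p>0. (\<integral>\<^sup>+ z. ennreal (min_abs n (cos_mat n) z powr p) \<partial>std_gaussian n)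
         \<le> (\<integral>\<^sup>+ z. ennreal (min_abs n A z powr p) \<partial>std_gaussian n))"
    by blast
qed

end
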